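(* Let $f(z)=\sum_{n=0}^{\infty}a_nz^n$ be analytic in $\mathbb{D}=\{z\in\mathbb{C}:|z|<1\}$ with $|f(z)|\le 1$ for all $z\in\mathbb{D}$. Then for all $r\le \frac13$, $$\sum_{n=0}^{\infty}|a_n|r^n+\left(\frac{1}{1+|a_0|}+\frac{r}{1-r}\right)\sum_{n=1}^{\infty}|a_n|^2r^{2n}+\frac{8}{9}\left(\frac{S_r}{\pi-S_r}\right)+\lambda\left(\frac{S_r}{\pi-S_r}\right)^2\le 1,$$ where $$\lambda=\frac{32(27+18\beta+27\beta^2-28\beta^3-15\beta^4-6\beta^5-7\beta^6)}{81(1+\beta)^3(3-5\beta)}=12.342793\ldots$$ and $\beta\approx 0.531615$ is the unique root in the interval $(0,1)$ of the equation $$81-126t-54t^2+14t^3-12t^4+2t^5+2t^6-2t^7-t^8=0.$$ Equality is achieved for the function $f_a(z)=\frac{a-z}{1-az}$ with $a=\beta$ (at $r=\frac13$).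
   Context: For $f(z)=\sum_{n=0}^\infty a_nz^n$ analytic in $\mathbb{D}$ and $0<r<1$, $S_r=S_r(f)=\int_{|w|<r}|f'(w)|^2\,dA(w)=\pi\sum_{n=1}^{\infty}n|a_n|^2r^{2n}$, where $dA$ is planar Lebesgue measure.
   Formalization: The printed decimal λ = 12.342793… is wrong: the closed formula at the exact root β gives λ ≈ 12.342748. The formal statement keeps the exact formula for λ and replaces the decimal by 12.3427 ≤ λ < 12.3428. *)

theory Defs
  imports "HOL-Analysis.Analysis"
begin

abbreviation unit_disc :: "complex set" where
  "unit_disc \<equiv> ball 0 1"

definition has_power_series :: "(complex \<Rightarrow> complex) \<Rightarrow> (nat \<Rightarrow> complex) \<Rightarrow> bool" where
  "has_power_series f a \<longleftrightarrow> (\<forall>z\<in>unit_disc. (\<lambda>n. a n * z ^ n) sums f z)"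

definition S :: "(complex \<Rightarrow> complex) \<Rightarrow> real \<Rightarrow> real" where
  "S f r = (LINT w:ball 0 r|lborel. (cmod (deriv f w))\<^sup>2)"

text \<open>In the theorem \<open>a\<close> is the coefficient sequence of \<open>f\<close>. For \<open>0 < r \<le> 1/3\<close> and \<open>f\<close> bounded
  by 1 on the disc both series converge and \<open>S f r < pi\<close>, so neither the default value of a
  divergent sum nor division by zero is involved. The sums starting at \<open>n = 1\<close> are shifted by one.\<close>

definition bohr_expr ::
    "real \<Rightarrow> (complex \<Rightarrow> complex) \<Rightarrow> (nat \<Rightarrow> complex) \<Rightarrow> real \<Rightarrow> real" where
  "bohr_expr \<Lambda> f a r =
     (\<Sum>n. cmod (a n) * r ^ n)
     + (1 / (1 + cmod (a 0)) + r / (1 - r)) * (\<Sum>n. (cmod (a (Suc n)))\<^sup>2 * r ^ (2 * Suc n))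
     + 8 / 9 * (S f r / (pi - S f r))
     + \<Lambda> * (S f r / (pi - S f r))\<^sup>2"

definition beta_root :: "real \<Rightarrow> bool" where
  "beta_root t \<longleftrightarrow> 0 < t \<and> t < 1 \<and>
     81 - 126 * t - 54 * t ^ 2 + 14 * t ^ 3 - 12 * t ^ 4 + 2 * t ^ 5 + 2 * t ^ 6 - 2 * t ^ 7 - t ^ 8 = 0"

text \<open>The description is proper because the theorem asserts \<open>\<exists>!t. beta_root t\<close>.\<close>

definition beta :: real where
  "beta = (THE t. beta_root t)"

text \<open>The value is 12.342748... at the exact root; the printed 12.342793... is off because the
  formula is sensitive to rounding \<open>beta\<close> (at 0.531615 it gives 12.342791...).\<close>

definition lam :: real where
  "lam = 32 * (27 + 18 * beta + 27 * beta ^ 2 - 28 * beta ^ 3 - 15 * beta ^ 4 - 6 * beta ^ 5 - 7 * beta ^ 6)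
         / (81 * (1 + beta) ^ 3 * (3 - 5 * beta))"

definition f_ext :: "real \<Rightarrow> complex \<Rightarrow> complex" where
  "f_ext a z = (of_real a - z) / (1 - of_real a * z)"

end

theory Submission
  imports Defs "HOL-Real_Asymp.Real_Asymp"
begin

text \<open>For a power series \<open>f\<close> bounded by 1 on the disc, the lower triangular Toeplitz matrices of its
  coefficients are contractions. Testing this on suitable vectors yields Carlson's inequalities for
  single coefficients, which sum up to the bound \<open>\<bar>a\<^sub>0\<bar> + (1 - \<bar>a\<^sub>0\<bar>\<^sup>2) r / (1 - r)\<close> for the first two terms,
  as well as \<open>\<bar>a\<^sub>n\<bar>\<^sup>2 \<le> (1 - \<bar>a\<^sub>0\<bar>\<^sup>2) (1 - \<Sum>k<n. \<bar>a\<^sub>k\<bar>\<^sup>2)\<close>. The latter shows that the partial sums of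
  \<open>\<bar>a\<^sub>n\<bar>\<^sup>2\<close>, \<open>n \<ge> 1\<close>, are at most those of the disc automorphism with the same \<open>\<bar>a\<^sub>0\<bar>\<close>; since \<open>n r\<^sup>2\<^sup>n\<close> is
  decreasing in \<open>n\<close> for \<open>2 r\<^sup>2 \<le> 1\<close>, summation by parts gives the sharp bound for \<open>S f r\<close>.
  Everything is extremal at \<open>r = 1 / 3\<close> for the automorphisms, so what remains is a one-variable inequality in
  \<open>t = \<bar>a\<^sub>0\<bar>\<close>, and \<open>lam\<close> is the minimum of the resulting quotient \<open>numer t / denom t\<close>, up to the factor \<open>32 / 81\<close>.\<close>

subsection \<open>The area formula\<close>

lemma nn_integral_lborel_reflect:
  fixes c :: "'a::euclidean_space"
  assumes [measurable]: "g \<in> borel_measurable borel"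
  shows "(\<integral>\<^sup>+x. g (c - x) \<partial>lborel) = (\<integral>\<^sup>+x. g x \<partial>lborel)"
proof -
  have "(\<integral>\<^sup>+x. g x \<partial>lborel) = (\<integral>\<^sup>+x. g x \<partial>(density (distr lborel borel (\<lambda>x. c + (-1) *\<^sub>R x)) (\<lambda>_. ennreal (\<bar>-1\<bar> ^ DIM('a)))))"
    by (subst lborel_affine[of "-1" c]) auto
  also have "\<dots> = (\<integral>\<^sup>+x. g (c - x) \<partial>lborel)"
    by (simp add: density_1 nn_integral_distr one_ennreal_def[symmetric])
  finally show ?thesis by simp
qed

lemma nn_integral_lborel_shift:
  fixes c :: "'a::euclidean_space"
  assumes [measurable]: "g \<in> borel_measurable borel"
  shows "(\<integral>\<^sup>+x. g (x - c) \<partial>lborel) = (\<integral>\<^sup>+x. g x \<partial>lborel)"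
proof -
  have "(\<integral>\<^sup>+x. g x \<partial>lborel) = (\<integral>\<^sup>+x. g x \<partial>(distr lborel borel ((+) (-c))))"
    by (simp add: lborel_distr_plus)
  also have "\<dots> = (\<integral>\<^sup>+x. g (x - c) \<partial>lborel)"
    by (subst nn_integral_distr) (auto simp: algebra_simps)
  finally show ?thesis by simp
qed

text \<open>Fubini's theorem for \<open>1\<^sub>A (R y) 1\<^sub>B (x - R y)\<close> with \<open>B\<close> the unit ball: translation invariance in \<open>x\<close>, and
  invariance under \<open>y \<mapsto> R\<^sup>-\<^sup>1 x - y\<close> for the other order of integration, compare the measures of \<open>A\<close>
  up to the factor \<open>\<bar>B\<bar>\<close>, and \<open>R\<close> maps \<open>B\<close> to itself.\<close>

lemma distr_lborel_orthogonal:
  fixes R :: "'a::euclidean_space \<Rightarrow> 'a"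
  assumes R: "orthogonal_transformation R"
  shows "distr lborel borel R = lborel"
proof (rule measure_eqI)
  have lin: "linear R" and nrm: "\<And>x. norm (R x) = norm x"
    using R by (auto simp: orthogonal_transformation)
  have surj: "surj R" using R by (rule orthogonal_transformation_surj)
  have [measurable]: "R \<in> borel_measurable borel"
    by (intro borel_measurable_continuous_onI linear_continuous_on linear_conv_bounded_linear[THEN iffD1] lin)
  fix A assume "A \<in> sets (distr lborel borel R)"
  then have A[measurable]: "A \<in> sets borel" by simp
  define B :: "'a set" where "B = ball 0 1"
  have [measurable]: "B \<in> sets borel" by (simp add: B_def)
  have RB: "indicator B (R y) = (indicator B y :: ennreal)" for y
    by (simp add: indicator_def B_def nrm)
  have B: "emeasure lborel B > 0" "emeasure lborel B < \<infinity>"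
    by (auto simp: B_def emeasure_ball unit_ball_vol_def)
  have "emeasure lborel B * (\<integral>\<^sup>+y. indicator A (R y) \<partial>lborel)
      = (\<integral>\<^sup>+y. (\<integral>\<^sup>+x. indicator A (R y) * indicator B (x - R y) \<partial>lborel) \<partial>lborel)"
  proof -
    have "(\<integral>\<^sup>+x. indicator A (R y) * indicator B (x - R y) \<partial>lborel) = emeasure lborel B * indicator A (R y)" for y
      by (subst nn_integral_cmult, simp, subst nn_integral_lborel_shift) (auto simp: mult.commute)
    then show ?thesis by (simp add: nn_integral_cmult)
  qed
  also have "\<dots> = (\<integral>\<^sup>+x. (\<integral>\<^sup>+y. indicator A (R y) * indicator B (x - R y) \<partial>lborel) \<partial>lborel)"
    by (rule lborel_pair.Fubini') measurable
  also have "\<dots> = (\<integral>\<^sup>+x. (\<integral>\<^sup>+y. indicator A (x - R y) * indicator B (R y) \<partial>lborel) \<partial>lborel)"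
  proof (rule nn_integral_cong)
    fix x
    obtain z where z: "x = R z" using surj by (metis surj_def)
    have "(\<integral>\<^sup>+y. indicator A (R y) * indicator B (x - R y) \<partial>lborel)
        = (\<integral>\<^sup>+y. indicator A (R (z - y)) * indicator B (x - R (z - y)) \<partial>lborel)"
      by (rule nn_integral_lborel_reflect[symmetric]) measurable
    then show "(\<integral>\<^sup>+y. indicator A (R y) * indicator B (x - R y) \<partial>lborel)
        = (\<integral>\<^sup>+y. indicator A (x - R y) * indicator B (R y) \<partial>lborel)"
      by (simp add: z linear_diff[OF lin])
  qed
  also have "\<dots> = (\<integral>\<^sup>+y. (\<integral>\<^sup>+x. indicator A (x - R y) * indicator B (R y) \<partial>lborel) \<partial>lborel)"
    by (rule lborel_pair.Fubini'[symmetric]) measurable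
  also have "\<dots> = emeasure lborel A * emeasure lborel B"
  proof -
    have "(\<integral>\<^sup>+x. indicator A (x - R y) * indicator B (R y) \<partial>lborel) = emeasure lborel A * indicator B y" for y
      by (subst nn_integral_multc, simp, subst nn_integral_lborel_shift) (auto simp: RB)
    then show ?thesis by (simp add: nn_integral_cmult)
  qed
  finally have "(\<integral>\<^sup>+y. indicator A (R y) \<partial>lborel) = emeasure lborel A"
    using B by (metis ennreal_mult_cancel_left infinity_ennreal_def less_irrefl mult.commute)
  then have "(\<integral>\<^sup>+y. indicator A y \<partial>distr lborel borel R) = emeasure lborel A"
    by (subst nn_integral_distr) auto
  then show "emeasure (distr lborel borel R) A = emeasure lborel A" by simp
qed simp

text \<open>Layer cake: \<open>r\<^sup>k - \<bar>w\<bar>\<^sup>k\<close> is the integral of \<open>k s\<^sup>k\<^sup>-\<^sup>1\<close> over \<open>\<bar>w\<bar> < s < r\<close>.\<close>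

lemma nn_integral_moment_disc:
  assumes r: "0 < r"
  shows "(\<integral>\<^sup>+w. ennreal (r ^ k - cmod w ^ k) * indicator (ball 0 r) w \<partial>lborel) = ennreal (pi * k * r ^ (k + 2) / (k + 2))"
proof -
  have [measurable]: "{p :: complex \<times> real. cmod (fst p) < snd p \<and> snd p < r} \<in> sets (borel \<Otimes>\<^sub>M borel)"
    unfolding borel_prod
    by (intro borel_open open_Collect_conj open_Collect_less) (auto intro!: continuous_intros)
  have inner: "(\<integral>\<^sup>+s. ennreal (k * s ^ (k - 1)) * indicator {p. cmod (fst p) < snd p \<and> snd p < r} (w, s) \<partial>lborel)
      = ennreal (r ^ k - cmod w ^ k) * indicator (ball 0 r) w" for w
  proof (cases "cmod w < r")
    case True
    have "(\<integral>\<^sup>+s. ennreal (k * s ^ (k - 1)) * indicator {p. cmod (fst p) < snd p \<and> snd p < r} (w, s) \<partial>lborel)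
        = (\<integral>\<^sup>+s. ennreal (k * s ^ (k - 1)) * indicator {cmod w..r} s \<partial>lborel)"
      by (intro nn_integral_cong_AE AE_I[where N="{cmod w, r}"])
         (auto simp: indicator_def emeasure_lborel_countable)
    also have "\<dots> = ennreal (r ^ k - cmod w ^ k)"
      using True by (intro nn_integral_FTC_Icc[where F="\<lambda>s. s ^ k"])
        (auto intro!: derivative_eq_intros mult_nonneg_nonneg zero_le_power elim: order.trans[rotated] simp: )
    finally show ?thesis using True by simp
  next
    case False
    then have "\<not> (cmod w < s \<and> s < r)" for s by linarith
    with False show ?thesis by simp
  qed
  have outer: "(\<integral>\<^sup>+w. ennreal (k * s ^ (k - 1)) * indicator {p. cmod (fst p) < snd p \<and> snd p < r} (w, s) \<partial>lborel)
      = ennreal (pi * k * s ^ (k + 1)) * indicator {0..r} s" if "s \<noteq> r" for s :: real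
  proof (cases "0 < s \<and> s < r")
    case True
    have "(\<integral>\<^sup>+w. ennreal (k * s ^ (k - 1)) * indicator {p. cmod (fst p) < snd p \<and> snd p < r} (w, s) \<partial>lborel)
        = (\<integral>\<^sup>+w. ennreal (k * s ^ (k - 1)) * indicator (ball 0 s) (w::complex) \<partial>lborel)"
      using True by (intro nn_integral_cong) (auto simp: indicator_def)
    also have "\<dots> = ennreal (k * s ^ (k - 1)) * ennreal (pi * s\<^sup>2)"
      using True by (subst nn_integral_cmult_indicator) (auto simp: emeasure_ball unit_ball_vol_2)
    \<comment> \<open>For \<open>k = 0\<close> the truncated exponent \<open>k - 1\<close> is
      harmless, since the factor \<open>k\<close> annihilates both sides.\<close>
    also have "\<dots> = ennreal (pi * k * s ^ (k + 1))"
      using True by (cases k) (auto simp flip: ennreal_mult' simp: power2_eq_square algebra_simps)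
    finally show ?thesis using True by simp
  next
    case False
    then have "s \<le> 0 \<or> s > r" using that by auto
    moreover have "\<not> cmod w < s" if "s \<le> 0" for w using that norm_ge_zero[of w] by linarith
    ultimately show ?thesis by (cases "s = 0") (auto simp: indicator_def)
  qed
  have "(\<integral>\<^sup>+w. ennreal (r ^ k - cmod w ^ k) * indicator (ball 0 r) w \<partial>lborel)
     = (\<integral>\<^sup>+s. (\<integral>\<^sup>+w. ennreal (k * s ^ (k - 1)) * indicator {p. cmod (fst p) < snd p \<and> snd p < r} (w, s) \<partial>lborel) \<partial>lborel)"
    unfolding inner[symmetric] by (rule lborel_pair.Fubini'[symmetric]) measurable
  also have "\<dots> = (\<integral>\<^sup>+s. ennreal (pi * k * s ^ (k + 1)) * indicator {0..r} s \<partial>lborel)"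
    by (intro nn_integral_cong_AE AE_I[where N="{r}"]) (use outer in \<open>auto\<close>)
  also have "\<dots> = ennreal (pi * k * r ^ (k + 2) / (k + 2) - pi * k * 0 ^ (k + 2) / (k + 2))"
  proof (rule nn_integral_FTC_Icc)
    show "((\<lambda>s. pi * k * s ^ (k + 2) / (k + 2)) has_real_derivative pi * k * s ^ (k + 1)) (at s)" for s :: real
      by (rule DERIV_cong[OF DERIV_cdivide[OF DERIV_cmult[OF DERIV_pow]]]) simp
  qed (use r in auto)
  finally show ?thesis by simp
qed

text \<open>\<open>nn_integral_moment_disc\<close> measures the complement
  \<open>r ^ k - cmod w ^ k\<close>; subtracting it from the integral of the constant
  \<open>r ^ k\<close> leaves the moment itself.\<close>

lemma integral_norm_power_disc:
  assumes r: "0 < r"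
  shows "(LINT w:ball 0 r|lborel. cmod w ^ k) = 2 * pi * r ^ (k + 2) / (k + 2)"
proof -
  have fin: "emeasure lborel (ball (0::complex) r) < \<infinity>" by (rule emeasure_bounded_finite) simp
  have int: "set_integrable lborel (ball (0::complex) r) (\<lambda>w. r ^ k - cmod w ^ k)"
    and int0: "set_integrable lborel (ball (0::complex) r) (\<lambda>w. r ^ k)"
    and int1: "set_integrable lborel (ball (0::complex) r) (\<lambda>w. cmod w ^ k)"
  proof -
    show int0: "set_integrable lborel (ball (0::complex) r) (\<lambda>w. r ^ k)"
      unfolding set_integrable_def using fin by (auto simp: less_top)
    show int1: "set_integrable lborel (ball (0::complex) r) (\<lambda>w. cmod w ^ k)"
    proof (rule set_integrable_bound[OF int0])
      show "set_borel_measurable lborel (ball (0::complex) r) (\<lambda>w. cmod w ^ k)"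
        using borel_measurable_continuous_on_indicator[of "ball 0 r" "\<lambda>w::complex. cmod w ^ k"]
        by (auto simp: set_borel_measurable_def intro!: continuous_intros)
    qed (use r in \<open>auto intro!: power_mono\<close>)
    show "set_integrable lborel (ball (0::complex) r) (\<lambda>w. r ^ k - cmod w ^ k)"
      by (intro set_integral_diff int0 int1)
  qed
  have "(LINT w:ball (0::complex) r|lborel. r ^ k - cmod w ^ k) = pi * k * r ^ (k + 2) / (k + 2)"
    unfolding set_lebesgue_integral_def
  proof (rule integral_eq_nn_integral[THEN trans])
    show "enn2real (\<integral>\<^sup>+ x. ennreal (indicat_real (ball 0 r) x *\<^sub>R (r ^ k - cmod x ^ k)) \<partial>lborel) = pi * k * r ^ (k + 2) / (k + 2)"
      using nn_integral_moment_disc[OF r, of k] r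
      by (simp add: ennreal_mult' mult.commute indicator_mult_ennreal)
  qed (auto intro!: AE_I2 simp: indicator_def power_mono)
  moreover have "(LINT w:ball (0::complex) r|lborel. r ^ k - cmod w ^ k) = r ^ k * (pi * r\<^sup>2) - (LINT w:ball 0 r|lborel. cmod w ^ k)"
  proof -
    have "(LINT w:ball (0::complex) r|lborel. r ^ k) = r ^ k * (pi * r\<^sup>2)"
      using r by (simp add: content_ball unit_ball_vol_2 set_lebesgue_integral_def)
    then show ?thesis using set_integral_diff(2)[OF int0 int1] by simp
  qed
  ultimately show ?thesis by (simp add: field_simps power_add power2_eq_square)
qed

lemma set_integrable_bounded_disc:
  fixes g :: "complex \<Rightarrow> 'a::{banach, second_countable_topology}"
  assumes "continuous_on (ball 0 r) g" and "\<And>w. cmod w < r \<Longrightarrow> norm (g w) \<le> K"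
  shows "set_integrable lborel (ball 0 r) g"
proof (rule set_integrable_bound)
  have "emeasure lborel (ball (0::complex) r) < \<infinity>" by (rule emeasure_bounded_finite) simp
  then show "set_integrable lborel (ball (0::complex) r) (\<lambda>w. K)"
    unfolding set_integrable_def by (auto simp: less_top)
  show "set_borel_measurable lborel (ball 0 r) g"
    using borel_measurable_continuous_on_indicator[OF _ assms(1)] by (simp add: set_borel_measurable_def)
qed (use assms(2) in \<open>force intro!: AE_I2\<close>)

section \<open>Orthogonality of monomials on discs\<close>

lemma integral_monomials_disc:
  assumes r: "0 < r"
  shows "(LINT w:ball 0 r|lborel. w ^ m * cnj (w ^ n)) = (if m = n then of_real (pi * r ^ (2 * n + 2) / (n + 1)) else 0)"
proof (cases "m = n")
  case True
  have "(cmod (w ^ n))\<^sup>2 = cmod w ^ (2 * n)" for w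
    by (simp add: norm_power mult.commute flip: power_mult)
  then have "w ^ m * cnj (w ^ n) = complex_of_real (cmod w ^ (2 * n))" for w
    using complex_norm_square[of "w ^ n"] True by simp
  then have "(LINT w:ball 0 r|lborel. w ^ m * cnj (w ^ n)) = (LINT w:ball 0 r|lborel. complex_of_real (cmod w ^ (2 * n)))"
    by simp
  also have "\<dots> = of_real (LINT w:ball 0 r|lborel. cmod w ^ (2 * n))"
    by (rule set_integral_complex_of_real)
  also have "\<dots> = of_real (pi * r ^ (2 * n + 2) / (n + 1))"
    by (simp add: integral_norm_power_disc[OF r] field_simps del: of_real_power of_real_mult of_real_divide)
  finally show ?thesis using True by simp
next
  case False
  \<comment> \<open>Rotation by this angle multiplies the integrand by \<open>cis pi = -1\<close>.
    Lebesgue measure is rotation invariant, so the integral equals its own negative; polar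
    coordinates are avoided.\<close>
  define u where "u = cis (pi / (real m - real n))"
  have u: "cmod u = 1" by (simp add: u_def)
  have "u ^ m * cnj u ^ n = cis (m * (pi / (real m - real n)) - n * (pi / (real m - real n)))"
    by (simp only: u_def cis_cnj Complex.DeMoivre cis_mult diff_conv_add_uminus mult_minus_right)
  also have "m * (pi / (real m - real n)) - n * (pi / (real m - real n)) = (real m - real n) * (pi / (real m - real n))"
    by (rule left_diff_distrib[symmetric])
  also have "\<dots> = pi" using False by simp
  finally have um: "u ^ m * cnj u ^ n = -1" by simp
  have "orthogonal_transformation ((*) u)"
    by (auto simp: orthogonal_transformation norm_mult u intro!: bounded_linear.linear bounded_linear_mult_right)
  then have distr: "distr lborel borel ((*) u) = lborel" by (rule distr_lborel_orthogonal)
  let ?g = "\<lambda>w. indicat_real (ball 0 r) w *\<^sub>R (w ^ m * cnj (w ^ n))"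
  have meas: "?g \<in> borel_measurable borel"
    by (rule borel_measurable_continuous_on_indicator) (auto intro!: continuous_intros)
  have "(\<integral>w. ?g w \<partial>lborel) = (\<integral>w. ?g w \<partial>distr lborel borel ((*) u))"
    by (simp add: distr)
  also have "\<dots> = (\<integral>w. ?g (u * w) \<partial>lborel)"
    by (rule integral_distr) (use meas in auto)
  also have "\<dots> = (\<integral>w. - ?g w \<partial>lborel)"
  proof (rule Bochner_Integration.integral_cong)
    fix w
    have "(u * w) ^ m * cnj ((u * w) ^ n) = (u ^ m * cnj u ^ n) * (w ^ m * cnj (w ^ n))"
      by (simp add: power_mult_distrib)
    then show "?g (u * w) = - ?g w" by (simp add: um indicator_def norm_mult u)
  qed simp
  also have "\<dots> = - (\<integral>w. ?g w \<partial>lborel)" by simp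
  finally have "(\<integral>w. ?g w \<partial>lborel) = 0" by simp
  then show ?thesis using False by (simp add: set_lebesgue_integral_def)
qed

text \<open>The squared modulus is a double sum of terms \<open>w ^ m * cnj (w ^ n)\<close>, of
  which only the diagonal survives integration.\<close>

lemma integral_polynomial_disc:
  fixes b :: "nat \<Rightarrow> complex"
  assumes r: "0 < r"
  shows "(LINT w:ball 0 r|lborel. (cmod (\<Sum>n<N. b n * w ^ n))\<^sup>2)
    = (\<Sum>n<N. (cmod (b n))\<^sup>2 * (pi * r ^ (2 * n + 2) / (n + 1)))"
proof -
  have int: "set_integrable lborel (ball 0 r) (\<lambda>w. b m * cnj (b n) * (w ^ m * cnj (w ^ n)))" for m n
  proof (rule set_integrable_bounded_disc)
    fix w assume "cmod w < r"
    then show "cmod (b m * cnj (b n) * (w ^ m * cnj (w ^ n))) \<le> cmod (b m) * cmod (b n) * (r ^ m * r ^ n)"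
      using r by (auto simp: norm_mult norm_power intro!: mult_mono power_mono)
  qed (auto intro!: continuous_intros)
  have "complex_of_real (LINT w:ball 0 r|lborel. (cmod (\<Sum>n<N. b n * w ^ n))\<^sup>2)
    = (LINT w:ball 0 r|lborel. (\<Sum>m<N. \<Sum>n<N. b m * cnj (b n) * (w ^ m * cnj (w ^ n))))"
  proof -
    have "complex_of_real ((cmod (\<Sum>n<N. b n * w ^ n))\<^sup>2) = (\<Sum>m<N. \<Sum>n<N. b m * cnj (b n) * (w ^ m * cnj (w ^ n)))" for w
      by (simp only: complex_norm_square cnj_sum sum_product) (simp add: algebra_simps)
    then show ?thesis by (simp only: set_integral_complex_of_real[symmetric])
  qed
  also have "\<dots> = (\<Sum>m<N. \<Sum>n<N. b m * cnj (b n) * (LINT w:ball 0 r|lborel. w ^ m * cnj (w ^ n)))"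
    using int unfolding set_lebesgue_integral_def set_integrable_def
    by (simp add: scaleR_sum_right Bochner_Integration.integral_sum mult_scaleR_right[symmetric]
        del: mult_scaleR_right complex_cnj_power complex_cnj_mult indicator_simps flip: integral_mult_right_zero)
  also have "\<dots> = complex_of_real (\<Sum>n<N. (cmod (b n))\<^sup>2 * (pi * r ^ (2 * n + 2) / (n + 1)))"
  proof -
    have "(\<Sum>n<N. b m * cnj (b n) * (LINT w:ball 0 r|lborel. w ^ m * cnj (w ^ n)))
        = complex_of_real ((cmod (b m))\<^sup>2 * (pi * r ^ (2 * m + 2) / (m + 1)))" if "m < N" for m
      unfolding integral_monomials_disc[OF r] of_real_mult[of "(cmod (b m))\<^sup>2"] complex_norm_square
      using that by (simp add: if_distrib[of "\<lambda>x. _ * x"] cong: if_cong del: of_real_mult of_real_divide)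
    then show ?thesis by (simp del: of_real_mult of_real_divide complex_cnj_power)
  qed
  finally show ?thesis by (simp only: of_real_eq_iff)
qed

section \<open>Power series in the unit disc\<close>

lemma power_series_norm_summable:
  fixes b :: "nat \<Rightarrow> complex"
  assumes "\<And>z. cmod z < 1 \<Longrightarrow> (\<lambda>n. b n * z ^ n) sums g z" and "0 \<le> r" "r < 1"
  shows "summable (\<lambda>n. cmod (b n) * r ^ n)"
proof -
  \<comment> \<open>Any point strictly between \<open>r\<close> and 1 will do: convergence there
    forces absolute convergence at \<open>r\<close>.\<close>
  define R where "R = (1 + r) / 2"
  have "summable (\<lambda>n. norm (b n * of_real r ^ n))"
  proof (rule powser_insidea)
    show "summable (\<lambda>n. b n * of_real R ^ n)"
      using assms by (intro sums_summable[OF assms(1)]) (auto simp: R_def simp del: of_real_add of_real_divide)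
    show "norm (complex_of_real r) < norm (complex_of_real R)"
      using assms by (simp add: R_def del: of_real_add of_real_divide)
  qed
  then show ?thesis using assms by (simp add: norm_mult norm_power)
qed

lemma power_series_has_field_derivative:
  fixes b :: "nat \<Rightarrow> complex"
  assumes g: "\<And>z. cmod z < 1 \<Longrightarrow> (\<lambda>n. b n * z ^ n) sums g z" and z: "cmod z < 1"
  shows "(g has_field_derivative (\<Sum>n. diffs b n * z ^ n)) (at z)"
proof (rule has_field_derivative_transform_within_open)
  show "((\<lambda>z. \<Sum>n. b n * z ^ n) has_field_derivative (\<Sum>n. diffs b n * z ^ n)) (at z)"
    by (rule termdiffs_strong'[OF _ z]) (rule sums_summable[OF g])
  show "open (ball (0::complex) 1)" by simp
qed (use z g in \<open>auto simp: sums_iff\<close>)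

lemma power_series_deriv_sums:
  fixes b :: "nat \<Rightarrow> complex"
  assumes "\<And>z. cmod z < 1 \<Longrightarrow> (\<lambda>n. b n * z ^ n) sums g z" and "cmod z < 1"
  shows "(\<lambda>n. diffs b n * z ^ n) sums deriv g z"
  using termdiffs_sums_strong[OF assms(1) power_series_has_field_derivative[OF assms] assms(2)]
    DERIV_imp_deriv[OF power_series_has_field_derivative[OF assms]] by simp

text \<open>Parseval on discs: the partial sums are bounded on \<open>ball 0 r\<close> by the
  convergent series \<open>K\<close>, so dominated convergence extends
  \<open>integral_polynomial_disc\<close>. It serves for \<open>deriv f\<close> and for the products
  in \<open>toeplitz_contraction\<close>.\<close>

lemma area_formula:
  fixes b :: "nat \<Rightarrow> complex"
  assumes g: "\<And>z. cmod z < 1 \<Longrightarrow> (\<lambda>n. b n * z ^ n) sums g z" and r: "0 < r" "r < 1"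
  shows "(\<lambda>n. (cmod (b n))\<^sup>2 * (pi * r ^ (2 * n + 2) / (n + 1))) sums (LINT w:ball 0 r|lborel. (cmod (g w))\<^sup>2)"
proof -
  define K where "K = (\<Sum>n. cmod (b n) * r ^ n)"
  have sm: "summable (\<lambda>n. cmod (b n) * r ^ n)"
    using power_series_norm_summable[OF g] r by simp
  let ?p = "\<lambda>N w. \<Sum>n<N. b n * w ^ n"
  have bnd: "cmod (?p N w) \<le> K" if "cmod w < r" for N w
  proof -
    have "cmod (?p N w) \<le> (\<Sum>n<N. cmod (b n) * r ^ n)"
      using that by (intro sum_norm_le) (auto simp: norm_mult norm_power intro!: mult_left_mono power_mono)
    also have "\<dots> \<le> K" unfolding K_def using sm r by (intro sum_le_suminf) auto
    finally show ?thesis .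
  qed
  have lim: "(\<lambda>N. ?p N w) \<longlonglongrightarrow> g w" if "cmod w < r" for w
    using g[of w] that r by (simp add: sums_def)
  have "(\<lambda>N. LINT w:ball 0 r|lborel. (cmod (?p N w))\<^sup>2) \<longlonglongrightarrow> (LINT w:ball 0 r|lborel. (cmod (g w))\<^sup>2)"
    unfolding set_lebesgue_integral_def
  proof (rule integral_dominated_convergence)
    have "continuous_on (ball 0 r) g"
      using r by (intro continuous_at_imp_continuous_on ballI DERIV_isCont[OF power_series_has_field_derivative[OF g]]) auto
    then have "continuous_on (ball 0 r) (\<lambda>w. (cmod (g w))\<^sup>2)" by (intro continuous_intros)
    then show "(\<lambda>w. indicat_real (ball 0 r) w *\<^sub>R (cmod (g w))\<^sup>2) \<in> borel_measurable lborel"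
      using borel_measurable_continuous_on_indicator[of "ball 0 r" "\<lambda>w. (cmod (g w))\<^sup>2"] by simp
    show "(\<lambda>w. indicat_real (ball 0 r) w *\<^sub>R (cmod (?p N w))\<^sup>2) \<in> borel_measurable lborel" for N
      using borel_measurable_continuous_on_indicator[of "ball 0 r" "\<lambda>w. (cmod (?p N w))\<^sup>2"]
      by (simp add: continuous_intros)
    show "integrable lborel (\<lambda>w::complex. indicat_real (ball 0 r) w *\<^sub>R K\<^sup>2)"
      using set_integrable_bounded_disc[of r "\<lambda>_. K\<^sup>2" "K\<^sup>2"] by (simp add: set_integrable_def)
    show "AE w in lborel. (\<lambda>N. indicat_real (ball 0 r) w *\<^sub>R (cmod (?p N w))\<^sup>2)
        \<longlonglongrightarrow> indicat_real (ball 0 r) w *\<^sub>R (cmod (g w))\<^sup>2"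
      by (rule AE_I2) (auto simp: indicator_def intro!: tendsto_intros lim)
    show "AE w in lborel. norm (indicat_real (ball 0 r) w *\<^sub>R (cmod (?p N w))\<^sup>2) \<le> indicat_real (ball 0 r) w *\<^sub>R K\<^sup>2" for N
      by (rule AE_I2) (auto simp: indicator_def intro!: power_mono bnd)
  qed
  then show ?thesis by (simp add: sums_def integral_polynomial_disc[OF r(1)])
qed

subsection \<open>Coefficients of bounded power series\<close>

text \<open>The coefficients of the product are the image of the vector \<open>c\<close>, cut off
  after \<open>N\<close>, under the lower triangular Toeplitz matrix of \<open>a\<close>.\<close>

lemma power_series_mult_polynomial:
  fixes a c :: "nat \<Rightarrow> complex"
  assumes f: "\<And>z. cmod z < 1 \<Longrightarrow> (\<lambda>n. a n * z ^ n) sums f z" and z: "cmod z < 1"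
  shows "(\<lambda>k. (\<Sum>i\<le>k. (if i \<le> N then c i else 0) * a (k - i)) * z ^ k) sums ((\<Sum>i\<le>N. c i * z ^ i) * f z)"
proof -
  let ?c = "\<lambda>i. (if i \<le> N then c i else 0) * z ^ i"
  have c: "?c sums (\<Sum>i\<le>N. c i * z ^ i)"
    using sums_finite[of "{..N}" ?c] by simp
  have "summable (\<lambda>i. norm (?c i))"
    by (rule summable_finite[of "{..N}"]) auto
  moreover have "summable (\<lambda>i. norm (a i * z ^ i))"
    using power_series_norm_summable[OF f, of "cmod z"] z by (simp add: norm_mult norm_power)
  ultimately have "(\<lambda>k. \<Sum>i\<le>k. ?c i * (a (k - i) * z ^ (k - i))) sums ((\<Sum>k. ?c k) * (\<Sum>k. a k * z ^ k))"
    by (rule Cauchy_product_sums)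
  moreover have "(\<Sum>i\<le>k. ?c i * (a (k - i) * z ^ (k - i))) = (\<Sum>i\<le>k. (if i \<le> N then c i else 0) * a (k - i)) * z ^ k" for k
    unfolding sum_distrib_right
  proof (rule sum.cong)
    fix i assume "i \<in> {..k}"
    then have "z ^ i * z ^ (k - i) = z ^ k" by (simp flip: power_add)
    then show "?c i * (a (k - i) * z ^ (k - i)) = (if i \<le> N then c i else 0) * a (k - i) * z ^ k"
      by (metis mult.assoc mult.left_commute)
  qed simp
  ultimately show ?thesis using c f[OF z] by (simp add: sums_iff)
qed

lemma power_series_mult_power:
  fixes b :: "nat \<Rightarrow> complex"
  assumes g: "\<And>z. cmod z < 1 \<Longrightarrow> (\<lambda>n. b n * z ^ n) sums g z" and z: "cmod z < 1"
  shows "(\<lambda>n. (if m \<le> n then b (n - m) else 0) * z ^ n) sums (z ^ m * g z)"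
proof -
  have "(\<lambda>n. (if m \<le> n + m then b (n + m - m) else 0) * z ^ (n + m)) sums (z ^ m * g z)"
    using sums_mult[OF g[OF z], of "z ^ m"] by (simp add: power_add algebra_simps)
  then show ?thesis by (subst (asm) sums_iff_shift) simp
qed

text \<open>Multiplication by \<open>w ^ m\<close> shifts the coefficients by \<open>m\<close>,
  hence the weights of index \<open>n + m\<close>.\<close>

lemma weighted_area_formula:
  fixes b :: "nat \<Rightarrow> complex"
  assumes g: "\<And>z. cmod z < 1 \<Longrightarrow> (\<lambda>n. b n * z ^ n) sums g z" and r: "0 < r" "r < 1"
  shows "(\<lambda>n. (cmod (b n))\<^sup>2 * (pi * r ^ (2 * (n + m) + 2) / (n + m + 1))) sums (LINT w:ball 0 r|lborel. (cmod (w ^ m * g w))\<^sup>2)"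
proof -
  have "(\<lambda>n. (cmod (if m \<le> n then b (n - m) else 0))\<^sup>2 * (pi * r ^ (2 * n + 2) / (n + 1))) sums (LINT w:ball 0 r|lborel. (cmod (w ^ m * g w))\<^sup>2)"
    by (rule area_formula[OF power_series_mult_power[OF g] r])
  then show ?thesis
    using sums_zero_iff_shift[of m "\<lambda>n. (cmod (if m \<le> n then b (n - m) else 0))\<^sup>2 * (pi * r ^ (2 * n + 2) / (n + 1))"]
    by simp
qed

text \<open>Weighting the Bergman norm with \<open>\<bar>w\<bar>\<^sup>2\<^sup>m\<close>, \<open>m \<rightarrow> \<infinity>\<close>, concentrates it on the unit circle and thereby
  yields the Hardy space statement without boundary integrals.\<close>

lemma toeplitz_contraction:
  fixes a c :: "nat \<Rightarrow> complex"
  assumes f: "\<And>z. cmod z < 1 \<Longrightarrow> (\<lambda>n. a n * z ^ n) sums f z" and bound: "\<And>z. cmod z < 1 \<Longrightarrow> cmod (f z) \<le> 1"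
  shows "(\<Sum>k\<le>N. (cmod (\<Sum>i\<le>k. c i * a (k - i)))\<^sup>2) \<le> (\<Sum>k\<le>N. (cmod (c k))\<^sup>2)"
proof -
  define F where "F k = (\<Sum>i\<le>k. (if i \<le> N then c i else 0) * a (k - i))" for k
  define c' where "c' i = (if i \<le> N then c i else 0)" for i
  define p where "p z = (\<Sum>i\<le>N. c i * z ^ i)" for z
  have Fs: "(\<lambda>k. F k * z ^ k) sums (p z * f z)" if "cmod z < 1" for z
    unfolding F_def p_def by (rule power_series_mult_polynomial[OF f that])
  have ps: "(\<lambda>k. c' k * z ^ k) sums p z" for z
    using sums_finite[of "{..N}" "\<lambda>k. c' k * z ^ k"] by (simp add: c'_def p_def)
  let ?w = "\<lambda>m r k. pi * r ^ (2 * (k + m) + 2) / (k + m + 1) :: real"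
  \<comment> \<open>The pointwise bound \<open>cmod (f w) \<le> 1\<close> compares the weighted
    norms of \<open>p * f\<close> and \<open>p\<close>; on the left the coefficients of index above
    \<open>N\<close> are discarded, on the right there are none.\<close>
  have 1: "(\<Sum>k\<le>N. (cmod (F k))\<^sup>2 * ?w m r k) \<le> (\<Sum>k\<le>N. (cmod (c k))\<^sup>2 * ?w m r k)" if r: "0 < r" "r < 1" for m r
  proof -
    note FA = weighted_area_formula[OF Fs r, of m] and pA = weighted_area_formula[OF ps r, of m]
    have "(\<Sum>k\<le>N. (cmod (F k))\<^sup>2 * ?w m r k) \<le> (\<Sum>k. (cmod (F k))\<^sup>2 * ?w m r k)"
      using sums_summable[OF FA] r by (intro sum_le_suminf) auto
    also have "\<dots> = (LINT w:ball 0 r|lborel. (cmod (w ^ m * (p w * f w)))\<^sup>2)"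
      using FA by (simp add: sums_iff)
    also have "\<dots> \<le> (LINT w:ball 0 r|lborel. (cmod (w ^ m * p w))\<^sup>2)"
    proof -
      have cf: "continuous_on (ball 0 r) f"
        using r by (intro continuous_at_imp_continuous_on ballI DERIV_isCont[OF power_series_has_field_derivative[OF f]]) auto
      have cp: "continuous_on UNIV p" unfolding p_def by (intro continuous_intros)
      then have cp': "continuous_on (ball 0 r) p" by (rule continuous_on_subset) simp
      have pb: "cmod (p w) \<le> (\<Sum>i\<le>N. cmod (c i))" if "cmod w < r" for w
        unfolding p_def using that r
        by (intro sum_norm_le) (auto simp: norm_mult norm_power intro!: mult_left_le power_le_one)
      have le: "(cmod (w ^ m * (p w * f w)))\<^sup>2 \<le> (cmod (w ^ m * p w))\<^sup>2" if "cmod w < r" for w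
        using bound[of w] that r by (auto simp: norm_mult intro!: power_mono mult_left_mono mult_left_le)
      have le': "(cmod (w ^ m * p w))\<^sup>2 \<le> (\<Sum>i\<le>N. cmod (c i))\<^sup>2" if "cmod w < r" for w
        using pb[OF that] that r power_le_one[of "cmod w" m]
        by (auto simp: norm_mult norm_power intro!: power_mono order.trans[OF mult_left_le_one_le])
      show ?thesis
      proof (rule set_integral_mono)
        show "set_integrable lborel (ball 0 r) (\<lambda>w. (cmod (w ^ m * (p w * f w)))\<^sup>2)"
          by (rule set_integrable_bounded_disc[where K="(\<Sum>i\<le>N. cmod (c i))\<^sup>2"])
             (auto intro!: continuous_intros cf cp' order.trans[OF le le'])
        show "set_integrable lborel (ball 0 r) (\<lambda>w. (cmod (w ^ m * p w))\<^sup>2)"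
          by (rule set_integrable_bounded_disc[where K="(\<Sum>i\<le>N. cmod (c i))\<^sup>2"])
             (use le' in \<open>auto intro!: continuous_intros cp'\<close>)
      qed (use le in auto)
    qed
    also have "\<dots> = (\<Sum>k. (cmod (c' k))\<^sup>2 * ?w m r k)"
      using pA by (simp add: sums_iff)
    also have "\<dots> = (\<Sum>k\<le>N. (cmod (c k))\<^sup>2 * ?w m r k)"
      by (subst suminf_finite[of "{..N}"]) (auto simp: c'_def)
    finally show ?thesis .
  qed
  define rr :: "nat \<Rightarrow> real" where "rr n = 1 - 1 / (n + 2)" for n
  have rr: "rr \<longlonglongrightarrow> 1" unfolding rr_def by real_asymp
  have w_lim: "(\<lambda>n. ?w m (rr n) k) \<longlonglongrightarrow> ?w m 1 k" for m k
    by (intro tendsto_intros rr) simp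
  have 2: "(\<Sum>k\<le>N. (cmod (F k))\<^sup>2 * ?w m 1 k) \<le> (\<Sum>k\<le>N. (cmod (c k))\<^sup>2 * ?w m 1 k)" for m
    by (rule LIMSEQ_le[where X="\<lambda>n. \<Sum>k\<le>N. (cmod (F k))\<^sup>2 * ?w m (rr n) k" and Y="\<lambda>n. \<Sum>k\<le>N. (cmod (c k))\<^sup>2 * ?w m (rr n) k"])
       (intro tendsto_intros w_lim | intro exI allI impI 1 | simp add: rr_def)+
  \<comment> \<open>Normalised by \<open>(m + 1) / pi\<close>, every weight tends to 1 as
    \<open>m\<close> grows, which leaves plain sums of squares.\<close>
  have w1: "(m + 1) / pi * ?w m 1 k = (m + 1) / (k + m + 1)" for m k by simp
  have 3: "(\<Sum>k\<le>N. (cmod (F k))\<^sup>2 * ((m + 1) / (k + m + 1))) \<le> (\<Sum>k\<le>N. (cmod (c k))\<^sup>2 * ((m + 1) / (k + m + 1)))" for m :: nat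
    using mult_left_mono[OF 2[of m], of "(m + 1) / pi"]
    by (simp add: sum_distrib_left mult.left_commute[of "_ / pi"] w1 mult.commute del: of_nat_Suc)
  have lim: "(\<lambda>m::nat. (m + 1) / (k + m + 1) :: real) \<longlonglongrightarrow> 1" for k :: nat by real_asymp
  have t: "(\<lambda>m. \<Sum>k\<le>N. (cmod (x k))\<^sup>2 * ((m + 1) / (k + m + 1))) \<longlonglongrightarrow> (\<Sum>k\<le>N. (cmod (x k))\<^sup>2 * 1)" for x :: "nat \<Rightarrow> complex"
    by (intro tendsto_intros lim)
  have "(\<Sum>k\<le>N. (cmod (F k))\<^sup>2 * 1) \<le> (\<Sum>k\<le>N. (cmod (c k))\<^sup>2 * 1)"
    by (rule LIMSEQ_le[OF t t]) (use 3 in auto)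
  moreover have "F k = (\<Sum>i\<le>k. c i * a (k - i))" if "k \<le> N" for k
    unfolding F_def using that by (intro sum.cong) auto
  ultimately show ?thesis by simp
qed

section \<open>Coefficient inequalities\<close>

text \<open>A locale, so that the bounds can be instantiated for \<open>z * f z\<close> and for
  \<open>f_ext b\<close>.\<close>

locale bounded_power_series =
  fixes f :: "complex \<Rightarrow> complex" and a :: "nat \<Rightarrow> complex"
  assumes sums: "cmod z < 1 \<Longrightarrow> (\<lambda>n. a n * z ^ n) sums f z"
    and bound: "cmod z < 1 \<Longrightarrow> cmod (f z) \<le> 1"
begin

lemma contraction: "(\<Sum>k\<le>N. (cmod (\<Sum>i\<le>k. c i * a (k - i)))\<^sup>2) \<le> (\<Sum>k\<le>N. (cmod (c k))\<^sup>2)"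
  by (rule toeplitz_contraction[OF sums bound])

text \<open>Contraction on the first unit vector, which is mapped to the coefficient sequence
  itself.\<close>

lemma sum_square_coeffs_le_1: "(\<Sum>k\<le>N. (cmod (a k))\<^sup>2) \<le> 1"
proof -
  have "(\<Sum>i\<le>k. (if i = 0 then 1 else 0) * a (k - i)) = a k" for k
    by (simp add: if_distrib[of "\<lambda>x. x * _"] cong: if_cong)
  then show ?thesis
    using contraction[where c="\<lambda>i. if i = 0 then 1 else 0" and N=N]
    by (simp add: if_distrib[of cmod] if_distrib[of "\<lambda>x. x\<^sup>2"] cong: if_cong)
qed

lemma norm_coeff_0_le_1: "cmod (a 0) \<le> 1"
  using sum_square_coeffs_le_1[of 0] by (simp add: power_le_one_iff abs_square_le_1)

text \<open>The contraction is tested on the vector with entries 1 at index 0 and \<open>y\<close>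
  at \<open>n\<close>. Rows below \<open>n\<close> still give \<open>a k\<close>, and row
  \<open>n\<close> gives \<open>a n + y * a 0\<close>; the gain there over the cost
  \<open>(cmod y)\<^sup>2\<close> yields the bound.\<close>

lemma coeff_sharp_bound:
  assumes n: "n > 0"
  shows "(cmod (a n))\<^sup>2 \<le> (1 - (cmod (a 0))\<^sup>2) * (1 - (\<Sum>k<n. (cmod (a k))\<^sup>2))"
proof (cases "cmod (a 0) = 1")
  \<comment> \<open>Here \<open>\<delta>\<close> would be 0 and \<open>y\<close> a division by zero;
    the bound on the square sum forces \<open>a n = 0\<close> instead.\<close>
  case True
  have "(\<Sum>k\<in>{0, n}. (cmod (a k))\<^sup>2) \<le> (\<Sum>k\<le>n. (cmod (a k))\<^sup>2)"
    by (intro sum_mono2) auto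
  moreover have "(\<Sum>k\<in>{0, n}. (cmod (a k))\<^sup>2) = 1 + (cmod (a n))\<^sup>2" using n True by simp
  ultimately have "(cmod (a n))\<^sup>2 \<le> 0" using sum_square_coeffs_le_1[of n] by linarith
  then show ?thesis using True by simp
next
  case False
  define \<delta> where "\<delta> = 1 - (cmod (a 0))\<^sup>2"
  have \<delta>: "\<delta> > 0" using False norm_coeff_0_le_1 by (simp add: \<delta>_def abs_square_less_1)
  \<comment> \<open>The maximiser of
    \<open>(cmod (a n + y * a 0))\<^sup>2 - (cmod y)\<^sup>2\<close>; with it row \<open>n\<close>
    becomes \<open>a n / \<delta>\<close>.\<close>
  define y where "y = cnj (a 0) * a n / of_real \<delta>"
  let ?c = "\<lambda>i. if i = 0 then 1 else if i = n then y else 0"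
  have c: "(\<Sum>k\<le>n. (cmod (?c k))\<^sup>2) = 1 + (cmod y)\<^sup>2"
  proof -
    have "(\<Sum>k\<le>n. (cmod (?c k))\<^sup>2) = (\<Sum>k\<in>{0, n}. (cmod (?c k))\<^sup>2)"
      by (intro sum.mono_neutral_right) auto
    then show ?thesis using n by simp
  qed
  have low: "(\<Sum>i\<le>k. ?c i * a (k - i)) = a k" if "k < n" for k
  proof -
    have "(\<Sum>i\<le>k. ?c i * a (k - i)) = (\<Sum>i\<le>k. if i = 0 then a k else 0)"
      using that by (intro sum.cong) auto
    then show ?thesis by simp
  qed
  have top: "(\<Sum>i\<le>n. ?c i * a (n - i)) = a n / of_real \<delta>"
  proof -
    have "(\<Sum>i\<le>n. ?c i * a (n - i)) = (\<Sum>i\<in>{0, n}. ?c i * a (n - i))"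
      by (intro sum.mono_neutral_right) auto
    also have "\<dots> = a n + y * a 0" using n by simp
    also have "\<dots> = a n * (of_real \<delta> + a 0 * cnj (a 0)) / of_real \<delta>" using \<delta> by (simp add: y_def field_simps)
    also have "of_real \<delta> + a 0 * cnj (a 0) = 1" by (simp add: \<delta>_def complex_norm_square[symmetric] del: of_real_power)
    finally show ?thesis by simp
  qed
  have "(\<Sum>k\<le>n. (cmod (\<Sum>i\<le>k. ?c i * a (k - i)))\<^sup>2)
      = (\<Sum>k<n. (cmod (a k))\<^sup>2) + (cmod (a n) / \<delta>)\<^sup>2"
  proof -
    have "{..n} = insert n {..<n}" by auto
    then have "(\<Sum>k\<le>n. (cmod (\<Sum>i\<le>k. ?c i * a (k - i)))\<^sup>2)
      = (cmod (\<Sum>i\<le>n. ?c i * a (n - i)))\<^sup>2 + (\<Sum>k<n. (cmod (\<Sum>i\<le>k. ?c i * a (k - i)))\<^sup>2)"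
      by simp
    also have "(\<Sum>k<n. (cmod (\<Sum>i\<le>k. ?c i * a (k - i)))\<^sup>2) = (\<Sum>k<n. (cmod (a k))\<^sup>2)"
      by (intro sum.cong refl) (subst low, auto)
    finally show ?thesis unfolding top using \<delta> by (simp add: norm_divide)
  qed
  then have "(\<Sum>k<n. (cmod (a k))\<^sup>2) + (cmod (a n) / \<delta>)\<^sup>2 \<le> 1 + (cmod y)\<^sup>2"
    using contraction[where c="?c" and N=n] unfolding c by simp
  moreover have "(cmod y)\<^sup>2 = (1 - \<delta>) * (cmod (a n) / \<delta>)\<^sup>2"
  proof -
    have "cmod y = cmod (a 0) * (cmod (a n) / \<delta>)"
      using \<delta> by (simp add: y_def norm_divide norm_mult)
    moreover have "1 - \<delta> = (cmod (a 0))\<^sup>2" by (simp add: \<delta>_def)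
    ultimately show ?thesis by (simp only: power_mult_distrib)
  qed
  ultimately have "\<delta> * (cmod (a n) / \<delta>)\<^sup>2 \<le> 1 - (\<Sum>k<n. (cmod (a k))\<^sup>2)" by (simp add: algebra_simps)
  then have "\<delta> * (\<delta> * (cmod (a n) / \<delta>)\<^sup>2) \<le> \<delta> * (1 - (\<Sum>k<n. (cmod (a k))\<^sup>2))"
    using \<delta> by (intro mult_left_mono) auto
  then show ?thesis using \<delta> unfolding \<delta>_def[symmetric] by (simp add: power_divide power2_eq_square)
qed

text \<open>The contraction is tested on the vector \<open>c\<close> below; \<open>u\<close> aligns the phases in its last row, and the
  middle entry \<open>y\<close> minimises \<open>(1 + \<alpha>) \<bar>y\<bar>\<^sup>2 - 2 \<bar>a\<^sub>n\<bar> \<bar>y\<bar>\<close>.\<close>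

lemma coeff_even_bound:
  assumes n: "n > 0"
  shows "cmod (a (2 * n)) \<le> 1 - (\<Sum>k<n. (cmod (a k))\<^sup>2) - (cmod (a n))\<^sup>2 / (1 + cmod (a 0))"
proof -
  define s where "s = (\<Sum>k<n. (cmod (a k))\<^sup>2)"
  define \<alpha> where "\<alpha> = cmod (a 0)"
  have \<alpha>: "\<alpha> \<ge> 0" by (simp add: \<alpha>_def)
  have s0: "s \<ge> 0" unfolding s_def by (intro sum_nonneg) auto
  obtain u where u: "u * cnj u = 1" "u * a (2 * n) = of_real (cmod (a (2 * n)))"
  proof (cases "a (2 * n) = 0")
    case True
    then show ?thesis using that[of 1] by simp
  next
    case False
    then show ?thesis
      using complex_norm_square[of "a (2 * n)"]
      by (intro that[of "cnj (a (2 * n)) / of_real (cmod (a (2 * n)))"]) (simp_all add: power2_eq_square field_simps)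
  qed
  have "(cmod u)\<^sup>2 = 1"
    using arg_cong[OF u(1), of cmod] by (simp add: norm_mult power2_eq_square)
  then have cu: "cmod u = 1" by (smt (verit) norm_ge_zero power2_eq_1_iff)
  define y where "y = cnj (u * a n) / of_real (1 + \<alpha>)"
  have y: "cmod y = cmod (a n) / (1 + \<alpha>)"
    using \<alpha> by (simp add: y_def norm_divide norm_mult cu del: of_real_add)
  define c where "c i = (if i = 0 then 1 else if i = n then y else if n < i then cnj (u * a (2 * n - i)) else 0)" for i
  \<comment> \<open>The upper half of the indices is read backwards, since row \<open>2 * n\<close>
    pairs entry \<open>2 * n - k\<close> of \<open>c\<close> with \<open>a k\<close>.\<close>
  have split: "(\<Sum>i\<le>2 * n. h i) = h 0 + h n + (\<Sum>i\<in>{0<..<n}. h i) + (\<Sum>k<n. h (2 * n - k))" for h :: "nat \<Rightarrow> 'b::comm_monoid_add"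
  proof -
    have "{..2 * n} = insert 0 (insert n ({0<..<n} \<union> {n<..2 * n}))" by auto
    moreover have "(\<Sum>i\<in>{n<..2 * n}. h i) = (\<Sum>k<n. h (2 * n - k))"
      by (rule sum.reindex_bij_witness[of _ "\<lambda>k. 2 * n - k" "\<lambda>i. 2 * n - i"]) auto
    moreover have "{0<..<n} \<inter> {n<..2 * n} = {}" by auto
    ultimately show ?thesis using n by (simp add: sum.union_disjoint add.assoc)
  qed
  have c_high: "c (2 * n - k) = cnj (u * a k)" if "k < n" for k
    using that by (auto simp: c_def)
  have c_norm: "(\<Sum>k\<le>2 * n. (cmod (c k))\<^sup>2) = 1 + (cmod y)\<^sup>2 + s"
  proof -
    have "(\<Sum>k<n. (cmod (c (2 * n - k)))\<^sup>2) = s"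
      by (simp add: s_def norm_mult cu c_high)
    then show ?thesis using n by (simp add: split c_def)
  qed
  have low: "(\<Sum>i\<le>k. c i * a (k - i)) = a k" if "k < n" for k
  proof -
    have "(\<Sum>i\<le>k. c i * a (k - i)) = (\<Sum>i\<le>k. if i = 0 then a k else 0)"
      using that by (intro sum.cong) (auto simp: c_def)
    then show ?thesis by simp
  qed
  have mid: "(\<Sum>i\<le>n. c i * a (n - i)) = a n + y * a 0"
  proof -
    have "(\<Sum>i\<le>n. c i * a (n - i)) = (\<Sum>i\<in>{0, n}. c i * a (n - i))"
      by (intro sum.mono_neutral_right) (auto simp: c_def)
    then show ?thesis using n by (simp add: c_def)
  qed
  have top: "u * (\<Sum>i\<le>2 * n. c i * a (2 * n - i)) = of_real (cmod (a (2 * n)) + (cmod (a n))\<^sup>2 / (1 + \<alpha>) + s)"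
  proof -
    have "(\<Sum>i\<le>2 * n. c i * a (2 * n - i)) = a (2 * n) + y * a n + (\<Sum>k<n. cnj (u * a k) * a k)"
    proof -
      have "(\<Sum>k<n. c (2 * n - k) * a (2 * n - (2 * n - k))) = (\<Sum>k<n. cnj (u * a k) * a k)"
        by (intro sum.cong) (auto simp: c_high)
      moreover have "2 * n - n = n" by simp
      ultimately show ?thesis using n unfolding split by (simp add: c_def)
    qed
    then have "u * (\<Sum>i\<le>2 * n. c i * a (2 * n - i))
        = u * a (2 * n) + (u * cnj u) * (a n * cnj (a n)) / of_real (1 + \<alpha>) + (\<Sum>k<n. (u * cnj u) * (a k * cnj (a k)))"
      by (simp add: y_def sum_distrib_left algebra_simps del: of_real_add)
    also have "\<dots> = of_real (cmod (a (2 * n))) + of_real ((cmod (a n))\<^sup>2) / of_real (1 + \<alpha>) + (\<Sum>k<n. of_real ((cmod (a k))\<^sup>2))"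
      by (simp only: u mult_1_left complex_norm_square)
    finally show ?thesis by (simp add: s_def)
  qed
  have "s + (cmod (a n + y * a 0))\<^sup>2 + (cmod (a (2 * n)) + (cmod (a n))\<^sup>2 / (1 + \<alpha>) + s)\<^sup>2
      = (\<Sum>k\<in>insert (2 * n) (insert n {..<n}). (cmod (\<Sum>i\<le>k. c i * a (k - i)))\<^sup>2)"
  proof -
    have "cmod (\<Sum>i\<le>2 * n. c i * a (2 * n - i)) = cmod (u * (\<Sum>i\<le>2 * n. c i * a (2 * n - i)))"
      by (simp only: norm_mult cu mult_1_left)
    also have "\<dots> = cmod (a (2 * n)) + (cmod (a n))\<^sup>2 / (1 + \<alpha>) + s"
      unfolding top norm_of_real using \<alpha> s0 by simp
    finally show ?thesis
      using n low by (simp add: mid s_def)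
  qed
  also have "\<dots> \<le> (\<Sum>k\<le>2 * n. (cmod (\<Sum>i\<le>k. c i * a (k - i)))\<^sup>2)"
    by (intro sum_mono2) auto
  also have "\<dots> \<le> 1 + (cmod y)\<^sup>2 + s"
    using contraction[where c=c and N="2 * n"] unfolding c_norm .
  finally have main: "(cmod (a n + y * a 0))\<^sup>2 + (cmod (a (2 * n)) + (cmod (a n))\<^sup>2 / (1 + \<alpha>) + s)\<^sup>2 \<le> 1 + (cmod y)\<^sup>2"
    by simp
  \<comment> \<open>By the choice of \<open>y\<close>, row \<open>n\<close> contributes at least
    \<open>(cmod y)\<^sup>2\<close>; this cancels the cost of \<open>y\<close> on the right and
    leaves a square bounded by 1.\<close>
  have "cmod (a n) - cmod y * \<alpha> \<le> cmod (a n + y * a 0)"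
    using norm_diff_ineq[of "a n" "y * a 0"] by (simp add: norm_mult \<alpha>_def)
  moreover have "cmod (a n) - cmod y * \<alpha> = cmod y" using \<alpha> by (simp add: y field_simps)
  ultimately have "(cmod y)\<^sup>2 \<le> (cmod (a n + y * a 0))\<^sup>2" by (intro power_mono) auto
  with main have "(cmod (a (2 * n)) + (cmod (a n))\<^sup>2 / (1 + \<alpha>) + s)\<^sup>2 \<le> 1" by linarith
  then have "cmod (a (2 * n)) + (cmod (a n))\<^sup>2 / (1 + \<alpha>) + s \<le> 1" by (metis abs_le_D1 abs_square_le_1)
  then show ?thesis by (simp add: s_def \<alpha>_def)
qed

text \<open>The even bound for \<open>z * f z\<close>: its coefficients are shifted by one, so
  \<open>2 * n + 1\<close> becomes \<open>2 * Suc n\<close>, and its constant coefficient is 0, so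
  the last square enters with factor 1 and completes the sum.\<close>

lemma coeff_odd_bound: "cmod (a (2 * n + 1)) \<le> 1 - (\<Sum>k\<le>n. (cmod (a k))\<^sup>2)"
proof -
  let ?b = "\<lambda>k. if 1 \<le> k then a (k - 1) else 0"
  interpret zf: bounded_power_series "\<lambda>z. z * f z" ?b
  proof
    show "(\<lambda>n. ?b n * z ^ n) sums (z * f z)" if "cmod z < 1" for z
      using power_series_mult_power[OF sums that, of 1] by simp
    show "cmod (z * f z) \<le> 1" if "cmod z < 1" for z
      using bound[OF that] that by (simp add: norm_mult mult_le_one)
  qed
  have "(\<Sum>k<Suc n. (cmod (?b k))\<^sup>2) = (\<Sum>k<n. (cmod (a k))\<^sup>2)"
    by (simp add: sum.lessThan_Suc_shift del: sum.lessThan_Suc)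
  then show ?thesis
    using zf.coeff_even_bound[of "Suc n"] by (simp add: lessThan_Suc_atMost[symmetric] del: sum.lessThan_Suc) simp
qed

section \<open>The refined Bohr sum\<close>

lemma norm_summable:
  assumes "0 \<le> r" "r < 1"
  shows "summable (\<lambda>n. cmod (a n) * r ^ n)"
  using power_series_norm_summable[OF sums assms] .

lemma square_summable:
  assumes "0 \<le> r" "r < 1"
  shows "summable (\<lambda>n. (cmod (a n))\<^sup>2 * r ^ (2 * n))"
proof (rule summable_comparison_test')
  show "summable (\<lambda>n. r ^ n)" using assms by (simp add: summable_geometric)
  fix n
  have "(cmod (a n))\<^sup>2 \<le> (\<Sum>k\<le>n. (cmod (a k))\<^sup>2)" by (intro member_le_sum) auto
  then have "(cmod (a n))\<^sup>2 \<le> 1" using sum_square_coeffs_le_1[of n] by linarith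
  moreover have "r ^ (2 * n) \<le> r ^ n" using assms by (intro power_decreasing) auto
  ultimately show "norm ((cmod (a n))\<^sup>2 * r ^ (2 * n)) \<le> r ^ n"
    using assms mult_mono[of "(cmod (a n))\<^sup>2" 1 "r ^ (2 * n)" "r ^ n"] by (simp add: abs_mult)
qed

text \<open>The third summand on the left is a reserve for the tail: the geometric series that
  arises if every later coefficient is bounded by 1 minus the square sum so far. Each induction step
  spends part of it on two new coefficients.\<close>

lemma refined_bohr_partial:
  assumes r: "0 \<le> r" "r < 1"
  shows "(\<Sum>m\<le>2 * n. cmod (a m) * r ^ m) + (1 / (1 + cmod (a 0)) + r / (1 - r)) * (\<Sum>k<n. (cmod (a (Suc k)))\<^sup>2 * r ^ (2 * Suc k))
      + (1 - (\<Sum>k\<le>n. (cmod (a k))\<^sup>2)) * r ^ (2 * n + 1) / (1 - r)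
    \<le> cmod (a 0) + (1 - (cmod (a 0))\<^sup>2) * r / (1 - r)"
proof (induction n)
  case 0
  then show ?case by simp
next
  case (Suc n)
  define s where "s = (\<Sum>k\<le>n. (cmod (a k))\<^sup>2)"
  define b where "b = (cmod (a (Suc n)))\<^sup>2"
  define q where "q = r ^ (2 * n + 1)"
  define d where "d = 1 / (1 + cmod (a 0))"
  have q: "q \<ge> 0" using r by (simp add: q_def)
  have odd: "cmod (a (Suc (2 * n))) * q \<le> (1 - s) * q"
    using coeff_odd_bound[of n] q by (intro mult_right_mono) (simp_all add: s_def)
  have "cmod (a (2 * Suc n)) \<le> 1 - s - b * d"
    using coeff_even_bound[of "Suc n"] by (simp add: s_def b_def d_def lessThan_Suc_atMost)
  then have even: "cmod (a (2 * Suc n)) * (q * r) \<le> (1 - s - b * d) * (q * r)"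
    using q r by (intro mult_right_mono) auto
  \<comment> \<open>The weight of the new square is paid for exactly: \<open>d\<close> by the term
    \<open>b * d\<close> of the even bound, \<open>r / (1 - r)\<close> by the drop of the reserve
    from \<open>1 - s\<close> to \<open>1 - s - b\<close>.\<close>
  have "(1 - s) * q + (1 - s - b * d) * (q * r) + (d + r / (1 - r)) * (b * (q * r)) + (1 - s - b) * (q * r * r) / (1 - r)
      = (1 - s) * q / (1 - r)"
  proof -
    have "1 - r \<noteq> 0" using r by simp
    then show ?thesis by (simp add: divide_simps) (simp add: algebra_simps)
  qed
  with odd even Suc.IH show ?case
    by (simp add: s_def[symmetric] b_def[symmetric] q_def d_def[symmetric] algebra_simps)
qed

lemma refined_bohr:
  assumes r: "0 \<le> r" "r < 1"
  shows "(\<Sum>n. cmod (a n) * r ^ n) + (1 / (1 + cmod (a 0)) + r / (1 - r)) * (\<Sum>k. (cmod (a (Suc k)))\<^sup>2 * r ^ (2 * Suc k))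
    \<le> cmod (a 0) + (1 - (cmod (a 0))\<^sup>2) * r / (1 - r)"
proof (rule LIMSEQ_le_const2)
  \<comment> \<open>\<open>refined_bohr_partial\<close> has even upper indices only, so the limit is
    taken along this subsequence.\<close>
  have "(\<lambda>n. \<Sum>m\<le>2 * n. cmod (a m) * r ^ m) \<longlonglongrightarrow> (\<Sum>n. cmod (a n) * r ^ n)"
    using LIMSEQ_subseq_LIMSEQ[OF summable_LIMSEQ'[OF norm_summable[OF r]], of "\<lambda>n. 2 * n"]
    by (simp add: o_def strict_mono_def)
  moreover have "(\<lambda>n. \<Sum>k<n. (cmod (a (Suc k)))\<^sup>2 * r ^ (2 * Suc k)) \<longlonglongrightarrow> (\<Sum>k. (cmod (a (Suc k)))\<^sup>2 * r ^ (2 * Suc k))"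
    using square_summable[OF r] by (intro summable_LIMSEQ) (subst (asm) summable_Suc_iff[symmetric])
  ultimately show "(\<lambda>n. (\<Sum>m\<le>2 * n. cmod (a m) * r ^ m) + (1 / (1 + cmod (a 0)) + r / (1 - r)) * (\<Sum>k<n. (cmod (a (Suc k)))\<^sup>2 * r ^ (2 * Suc k)))
    \<longlonglongrightarrow> (\<Sum>n. cmod (a n) * r ^ n) + (1 / (1 + cmod (a 0)) + r / (1 - r)) * (\<Sum>k. (cmod (a (Suc k)))\<^sup>2 * r ^ (2 * Suc k))"
    by (intro tendsto_intros)
  have "(1 - (\<Sum>k\<le>n. (cmod (a k))\<^sup>2)) * r ^ (2 * n + 1) / (1 - r) \<ge> 0" for n
    using r sum_square_coeffs_le_1[of n] by auto
  then show "\<exists>N. \<forall>n\<ge>N. (\<Sum>m\<le>2 * n. cmod (a m) * r ^ m) + (1 / (1 + cmod (a 0)) + r / (1 - r)) * (\<Sum>k<n. (cmod (a (Suc k)))\<^sup>2 * r ^ (2 * Suc k))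
    \<le> cmod (a 0) + (1 - (cmod (a 0))\<^sup>2) * r / (1 - r)"
    using refined_bohr_partial[OF r] by (smt (verit))
qed

section \<open>The sharp area bound\<close>

text \<open>\<open>coeff_sharp_bound\<close> is a recursion: if \<open>A\<close> is the sum so far,
  the next one is at most \<open>\<delta>\<^sup>2 + (1 - \<delta>) * A\<close>. This is monotone in
  \<open>A\<close>, and the sums of the automorphism satisfy it with equality.\<close>

lemma sum_square_coeffs_dominated:
  "(\<Sum>k<n. (cmod (a (Suc k)))\<^sup>2) \<le> (\<Sum>k<n. ((1 - (cmod (a 0))\<^sup>2) * cmod (a 0) ^ k)\<^sup>2)"
proof (induction n)
  case (Suc n)
  define \<delta> where "\<delta> = 1 - (cmod (a 0))\<^sup>2"
  define A where "A = (\<Sum>k<n. (cmod (a (Suc k)))\<^sup>2)"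
  define B where "B = (\<Sum>k<n. (\<delta> * cmod (a 0) ^ k)\<^sup>2)"
  have \<delta>: "1 - \<delta> \<ge> 0" and d1: "1 - \<delta> = (cmod (a 0))\<^sup>2" by (simp_all add: \<delta>_def)
  have sum: "(\<Sum>k<Suc n. (cmod (a k))\<^sup>2) = 1 - \<delta> + A"
    by (simp add: sum.lessThan_Suc_shift A_def \<delta>_def del: sum.lessThan_Suc)
  have "A + (cmod (a (Suc n)))\<^sup>2 \<le> A + \<delta> * (1 - (1 - \<delta> + A))"
    using coeff_sharp_bound[of "Suc n"] unfolding sum \<delta>_def[symmetric] by simp
  also have "\<dots> = \<delta>\<^sup>2 + (1 - \<delta>) * A" by (simp add: algebra_simps power2_eq_square)
  finally have "A + (cmod (a (Suc n)))\<^sup>2 \<le> \<delta>\<^sup>2 + (1 - \<delta>) * A" .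
  also have "\<dots> \<le> \<delta>\<^sup>2 + (1 - \<delta>) * B"
    using Suc.IH \<delta> by (intro add_mono mult_left_mono) (simp_all add: A_def B_def \<delta>_def)
  also have "\<dots> = (\<Sum>k<Suc n. (\<delta> * cmod (a 0) ^ k)\<^sup>2)"
    unfolding B_def by (subst sum.lessThan_Suc_shift) (simp add: sum_distrib_left power_mult_distrib mult.left_commute d1)
  finally show ?case by (simp add: A_def \<delta>_def)
qed simp

end

text \<open>Summation by parts as an induction: passing from \<open>w n\<close> to the smaller
  \<open>w (Suc n)\<close> can only decrease a product with a nonnegative partial sum. For
  nonnegative weights the weighted sum is thus nonnegative.\<close>

lemma sum_decreasing_weights_nonneg:
  fixes w z :: "nat \<Rightarrow> real"
  assumes dec: "\<And>n. w (Suc n) \<le> w n" and Z: "\<And>n. 0 \<le> (\<Sum>k<n. z k)"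
  shows "w n * (\<Sum>k<n. z k) \<le> (\<Sum>k<n. w k * z k)"
proof (induction n)
  case (Suc n)
  have "w (Suc n) * (\<Sum>k<Suc n. z k) \<le> w n * (\<Sum>k<Suc n. z k)"
    using dec Z by (intro mult_right_mono)
  then show ?case using Suc.IH by (simp add: algebra_simps)
qed simp

context bounded_power_series
begin

text \<open>\<open>diffs\<close> contributes a factor \<open>(n + 1)\<^sup>2\<close>, the norm of
  the monomial a factor \<open>1 / (n + 1)\<close>; one \<open>n + 1\<close> survives.\<close>

lemma area_sums:
  fixes r :: real
  assumes r: "0 < r" "r < 1"
  shows "(\<lambda>n. real (Suc n) * r ^ (2 * Suc n) * (cmod (a (Suc n)))\<^sup>2) sums (S f r / pi)"
proof -
  have "(\<lambda>n. (cmod (diffs a n))\<^sup>2 * (pi * r ^ (2 * n + 2) / (n + 1)) / pi) sums (S f r / pi)"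
    unfolding S_def by (intro sums_divide area_formula power_series_deriv_sums sums r)
  moreover have "(cmod (diffs a n))\<^sup>2 * (pi * r ^ (2 * n + 2) / (n + 1)) / pi = real (Suc n) * r ^ (2 * Suc n) * (cmod (a (Suc n)))\<^sup>2" for n
    by (simp add: diffs_def norm_mult power2_eq_square divide_simps del: of_nat_Suc)
  ultimately show ?thesis by simp
qed

text \<open>The right-hand side is the value for the disc automorphism with the same
  \<open>cmod (a 0)\<close>, summed by the derivative of the geometric series.\<close>

lemma area_bound:
  assumes r: "0 < r" "2 * r\<^sup>2 \<le> 1"
  shows "S f r / pi \<le> r\<^sup>2 * (1 - (cmod (a 0))\<^sup>2)\<^sup>2 / (1 - (cmod (a 0))\<^sup>2 * r\<^sup>2)\<^sup>2"
proof -
  define \<alpha> where "\<alpha> = cmod (a 0)"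
  define b where "b k = (1 - \<alpha>\<^sup>2) * \<alpha> ^ k" for k
  define w where "w n = real (Suc n) * r ^ (2 * Suc n)" for n
  have r1: "r < 1"
    using r by (intro power_less_imp_less_base[of r 2 1]) auto
  have \<alpha>: "0 \<le> \<alpha>" "\<alpha> \<le> 1" using norm_coeff_0_le_1 by (simp_all add: \<alpha>_def)
  have "w (Suc n) \<le> w n" for n
  proof -
    \<comment> \<open>The ratio of consecutive weights is
      \<open>(n + 2) / (n + 1) * r\<^sup>2\<close>, largest at \<open>n = 0\<close>, where it is
      \<open>2 * r\<^sup>2\<close>.\<close>
    have "real (Suc (Suc n)) * r\<^sup>2 \<le> real (Suc n) * (2 * r\<^sup>2)" by (simp add: algebra_simps)
    also have "\<dots> \<le> real (Suc n) * 1" using r by (intro mult_left_mono) auto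
    finally have "real (Suc (Suc n)) * r\<^sup>2 * r ^ (2 * Suc n) \<le> real (Suc n) * 1 * r ^ (2 * Suc n)"
      using r by (intro mult_right_mono) auto
    then show ?thesis by (simp add: w_def power2_eq_square algebra_simps)
  qed
  moreover have "0 \<le> (\<Sum>k<n. (b k)\<^sup>2 - (cmod (a (Suc k)))\<^sup>2)" for n
    using sum_square_coeffs_dominated[of n] by (simp add: sum_subtractf b_def \<alpha>_def)
  ultimately have 1: "w n * (\<Sum>k<n. (b k)\<^sup>2 - (cmod (a (Suc k)))\<^sup>2) \<le> (\<Sum>k<n. w k * ((b k)\<^sup>2 - (cmod (a (Suc k)))\<^sup>2))" for n
    by (rule sum_decreasing_weights_nonneg)
  have 2: "0 \<le> w n * (\<Sum>k<n. (b k)\<^sup>2 - (cmod (a (Suc k)))\<^sup>2)" for n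
    using sum_square_coeffs_dominated[of n] r by (simp add: sum_subtractf b_def \<alpha>_def w_def)
  have le: "(\<Sum>k<n. w k * (cmod (a (Suc k)))\<^sup>2) \<le> (\<Sum>k<n. w k * (b k)\<^sup>2)" for n
    using order.trans[OF 2[of n] 1[of n]] by (simp only: right_diff_distrib sum_subtractf diff_ge_0_iff_ge)
  have "\<alpha>\<^sup>2 * r\<^sup>2 \<le> r\<^sup>2" using \<alpha> by (intro mult_left_le_one_le) (auto simp: power_le_one)
  then have "\<alpha>\<^sup>2 * r\<^sup>2 < 1" using r by linarith
  then have "norm (\<alpha>\<^sup>2 * r\<^sup>2) < 1" by simp
  note geometric_deriv_sums[OF this]
  then have "(\<lambda>n. r\<^sup>2 * (1 - \<alpha>\<^sup>2)\<^sup>2 * (of_nat (Suc n) * (\<alpha>\<^sup>2 * r\<^sup>2) ^ n)) sums (r\<^sup>2 * (1 - \<alpha>\<^sup>2)\<^sup>2 * (1 / (1 - \<alpha>\<^sup>2 * r\<^sup>2)\<^sup>2))"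
    by (rule sums_mult)
  moreover have "r\<^sup>2 * (1 - \<alpha>\<^sup>2)\<^sup>2 * (of_nat (Suc n) * (\<alpha>\<^sup>2 * r\<^sup>2) ^ n) = w n * (b n)\<^sup>2" for n
  proof -
    have "(\<alpha>\<^sup>2 * r\<^sup>2) ^ n = (\<alpha> ^ n)\<^sup>2 * r ^ (2 * n)"
      by (simp add: power_mult_distrib mult.commute flip: power_mult)
    moreover have "r ^ (2 * Suc n) = r\<^sup>2 * r ^ (2 * n)" by (simp add: power2_eq_square)
    ultimately show ?thesis
      unfolding w_def b_def power_mult_distrib[of "1 - \<alpha>\<^sup>2" "\<alpha> ^ n" 2] by (simp only: mult_ac)
  qed
  ultimately have "(\<lambda>n. w n * (b n)\<^sup>2) sums (r\<^sup>2 * (1 - \<alpha>\<^sup>2)\<^sup>2 / (1 - \<alpha>\<^sup>2 * r\<^sup>2)\<^sup>2)"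
    by (simp only: times_divide_eq_right mult_1_right)
  moreover have "(\<lambda>n. w n * (cmod (a (Suc n)))\<^sup>2) sums (S f r / pi)"
    using area_sums[OF r(1) r1] unfolding w_def .
  ultimately show ?thesis
    unfolding \<alpha>_def[symmetric] sums_def by (intro LIMSEQ_le[OF _ _ exI]) (use le in auto)
qed

lemma S_nonneg:
  assumes "0 < r" "r < 1"
  shows "S f r \<ge> 0"
proof -
  have "0 \<le> S f r / pi"
    by (rule sums_le[OF _ sums_zero area_sums[OF assms]]) (use assms in auto)
  then show ?thesis using pi_gt_zero by (auto simp: zero_le_divide_iff)
qed

end

subsection \<open>The one-variable inequality\<close>

text \<open>\<open>numer\<close> and \<open>denom\<close> are the cofactors in
  \<open>majorant_identity\<close>, left after \<open>(1 - t) ^ 3\<close> is taken out of the gap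
  between 1 and the majorant at \<open>r = 1 / 3\<close>.\<close>

definition numer :: "real \<Rightarrow> real" where
  "numer t = (9 - t ^ 4) * (7 + 3 * t + t ^ 2 + t ^ 3)"

definition denom :: "real \<Rightarrow> real" where
  "denom t = (1 - t) * (1 + t) ^ 4"

definition beta_poly :: "real \<Rightarrow> real" where
  "beta_poly t = 81 - 126 * t - 54 * t ^ 2 + 14 * t ^ 3 - 12 * t ^ 4 + 2 * t ^ 5 + 2 * t ^ 6 - 2 * t ^ 7 - t ^ 8"

lemma beta_poly_horner:
  "beta_poly t = 81 - t * (126 + t * (54 - t * (14 - t * (12 - t * (2 + t * (2 - t * (2 + t)))))))"
  unfolding beta_poly_def by (simp add: eval_nat_numeral algebra_simps)

text \<open>The numerator of the derivative of \<open>numer / denom\<close> without its factor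
  \<open>(1 + t) ^ 3\<close>: the first polynomial, the one in \<open>lam\<close>, is the derivative
  of \<open>numer\<close>, and \<open>(1 + t) ^ 3 * (3 - 5 * t)\<close> is that of
  \<open>denom\<close>.\<close>

lemma deriv_identity:
  fixes t :: real
  shows "(27 + 18 * t + 27 * t ^ 2 - 28 * t ^ 3 - 15 * t ^ 4 - 6 * t ^ 5 - 7 * t ^ 6) * ((1 - t) * (1 + t)) - numer t * (3 - 5 * t)
    = - 2 * beta_poly t"
  unfolding numer_def beta_poly_def by (simp add: eval_nat_numeral algebra_simps)

lemma beta_poly_strict_decreasing:
  assumes "0 \<le> s" "s < t" "t \<le> 1"
  shows "beta_poly t < beta_poly s"
proof (rule DERIV_neg_imp_decreasing[OF assms(2)])
  fix x assume x: "s \<le> x" "x \<le> t"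
  have p: "x ^ k \<le> 1" "0 \<le> x ^ k" for k using x assms by (auto simp: power_le_one)
  have "(beta_poly has_real_derivative - 126 - 108 * x + 42 * x ^ 2 - 48 * x ^ 3 + 10 * x ^ 4 + 12 * x ^ 5 - 14 * x ^ 6 - 8 * x ^ 7) (at x)"
    unfolding beta_poly_def[abs_def] by (auto intro!: derivative_eq_intros)
  \<comment> \<open>On the unit interval the positive terms are at most 42 + 10 + 12, well below
    126.\<close>
  moreover have "- 126 - 108 * x + 42 * x ^ 2 - 48 * x ^ 3 + 10 * x ^ 4 + 12 * x ^ 5 - 14 * x ^ 6 - 8 * x ^ 7 < 0"
    using p[of 1] p[of 2] p[of 3] p[of 4] p[of 5] p[of 6] p[of 7] x assms by linarith
  ultimately show "\<exists>y. (beta_poly has_real_derivative y) (at x) \<and> y < 0" by blast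
qed

text \<open>Existence by a sign change between neighbouring eight-digit decimals, uniqueness by
  strict monotonicity. The precision is used in \<open>lam_bounds\<close>.\<close>

lemma beta_root_unique_approx:
  "\<exists>!t. beta_root t" "beta_root beta" "53161472 / 10 ^ 8 \<le> beta" "beta \<le> 53161473 / 10 ^ 8"
proof -
  have iff: "beta_root t \<longleftrightarrow> 0 < t \<and> t < 1 \<and> beta_poly t = 0" for t
    unfolding beta_root_def beta_poly_def by (rule refl)
  have sign: "beta_poly (53161473 / 10 ^ 8) \<le> 0" "0 \<le> beta_poly (53161472 / 10 ^ 8)"
    unfolding beta_poly_horner by simp_all
  have "continuous_on {53161472 / 10 ^ 8..53161473 / 10 ^ 8} beta_poly"
    unfolding beta_poly_def[abs_def] by (intro continuous_intros)
  then obtain t where t: "53161472 / 10 ^ 8 \<le> t" "t \<le> 53161473 / 10 ^ 8" "beta_poly t = 0"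
    using IVT2'[of beta_poly, OF sign] by force
  have t01: "0 < t" "t < 1" using t by simp_all
  have uniq: "s = t" if "beta_root s" for s
  proof (rule ccontr)
    assume "s \<noteq> t"
    moreover have s: "0 < s" "s < 1" "beta_poly s = 0" using that by (simp_all add: iff)
    ultimately show False
      using beta_poly_strict_decreasing[of s t] beta_poly_strict_decreasing[of t s] t(3) t01 by linarith
  qed
  have root: "beta_root t" using t(3) t01 by (simp add: iff)
  then show ex1: "\<exists>!t. beta_root t" by (rule ex1I) (rule uniq)
  have beta: "beta = t" unfolding beta_def by (rule the1_equality[OF ex1 root])
  show "beta_root beta" "53161472 / 10 ^ 8 \<le> beta" "beta \<le> 53161473 / 10 ^ 8"
    unfolding beta by (fact root t(1) t(2))+
qed

text \<open>After clearing the positive denominator both bounds are linear in the powers of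
  \<open>beta\<close>, which are enclosed by the powers of the end points.\<close>

lemma lam_bounds: "123427 / 10 ^ 4 \<le> lam" "lam < 123428 / 10 ^ 4"
proof -
  note b = beta_root_unique_approx(3,4)
  have lo: "(53161472 / 10 ^ 8) ^ k \<le> beta ^ k" for k using b by (intro power_mono) auto
  have hi: "beta ^ k \<le> (53161473 / 10 ^ 8) ^ k" for k using b by (intro power_mono) auto
  note lh = lo[of 2] lo[of 3] lo[of 4] lo[of 5] lo[of 6] hi[of 2] hi[of 3] hi[of 4] hi[of 5] hi[of 6]
  have pos: "81 * (1 + beta) ^ 3 * (3 - 5 * beta) > 0" using b by (intro mult_pos_pos zero_less_power) auto
  have exp: "81 * (1 + beta) ^ 3 * (3 - 5 * beta) = 81 * (3 + 4 * beta - 6 * beta ^ 2 - 12 * beta ^ 3 - 5 * beta ^ 4)"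
    by algebra
  show "123427 / 10 ^ 4 \<le> lam" unfolding lam_def pos_le_divide_eq[OF pos] unfolding exp
    using lh b by (simp add: power_divide)
  show "lam < 123428 / 10 ^ 4" unfolding lam_def pos_divide_less_eq[OF pos] unfolding exp
    using lh b by (simp add: power_divide)
qed

text \<open>Stationarity of \<open>numer / denom\<close> at \<open>beta\<close> identifies \<open>lam\<close> with its critical value.\<close>

lemma lam_eq: "81 * lam / 32 * denom beta = numer beta"
proof -
  note b = beta_root_unique_approx(3,4)
  let ?n = "27 + 18 * beta + 27 * beta ^ 2 - 28 * beta ^ 3 - 15 * beta ^ 4 - 6 * beta ^ 5 - 7 * beta ^ 6"
  have 1: "?n * ((1 - beta) * (1 + beta)) = numer beta * (3 - 5 * beta)"
    using deriv_identity[of beta] beta_root_unique_approx(2) by (simp add: beta_root_def beta_poly_def)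
  have 2: "(1 + beta) ^ 3 \<noteq> 0" "3 - 5 * beta \<noteq> 0" using b by auto
  have 3: "81 * lam / 32 = ?n / ((1 + beta) ^ 3 * (3 - 5 * beta))" 
  proof -
    have "81 * (32 * A / (81 * B * C)) / 32 = A / (B * C)" for A B C :: real by simp
    then show ?thesis unfolding lam_def .
  qed
  have 4: "denom beta = (1 + beta) ^ 3 * ((1 - beta) * (1 + beta))" unfolding denom_def by algebra
  have "A / (B * C) * (B * m) = n" if "A * m = n * C" "B \<noteq> 0" "C \<noteq> 0" for A B C m n :: real
    using that by (simp add: field_simps)
  from this[OF 1 2] show ?thesis unfolding 3 4 .
qed

text \<open>On \<open>0 \<le> t < 1\<close> the derivative of \<open>numer / denom\<close> is a
  positive multiple of \<open>- beta_poly\<close>, so the quotient falls up to \<open>beta\<close>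
  and rises after it; its minimum is \<open>81 * lam / 32\<close> by \<open>lam_eq\<close>.\<close>

lemma lam_minimal:
  assumes t: "0 \<le> t" "t \<le> 1"
  shows "81 * lam / 32 * denom t \<le> numer t"
proof (cases "t = 1")
  \<comment> \<open>\<open>denom 1 = 0\<close> rules out the quotient here, but the claim is just
    \<open>0 \<le> numer 1\<close>.\<close>
  case True
  then show ?thesis by (simp add: denom_def numer_def)
next
  case False
  note b = beta_root_unique_approx(3,4)
  have b0: "beta_poly beta = 0" using beta_root_unique_approx(2) unfolding beta_root_def beta_poly_def by blast
  have dpos: "denom x > 0" if "0 \<le> x" "x < 1" for x using that by (simp add: denom_def)
  have der: "((\<lambda>x. numer x / denom x) has_real_derivative - 2 * beta_poly x * (1 + x) ^ 3 / (denom x)\<^sup>2) (at x)"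
    if "0 \<le> x" "x < 1" for x
  proof -
    let ?n = "27 + 18 * x + 27 * x ^ 2 - 28 * x ^ 3 - 15 * x ^ 4 - 6 * x ^ 5 - 7 * x ^ 6"
    have n: "(numer has_real_derivative ?n) (at x)"
      unfolding numer_def[abs_def] by (auto intro!: derivative_eq_intros simp: eval_nat_numeral algebra_simps)
    have d: "(denom has_real_derivative (1 + x) ^ 3 * (3 - 5 * x)) (at x)"
      unfolding denom_def[abs_def] by (auto intro!: derivative_eq_intros simp: eval_nat_numeral algebra_simps)
    have "?n * denom x - numer x * ((1 + x) ^ 3 * (3 - 5 * x))
        = (?n * ((1 - x) * (1 + x)) - numer x * (3 - 5 * x)) * (1 + x) ^ 3"
    proof -
      have d: "denom x = (1 + x) ^ 3 * ((1 - x) * (1 + x))" unfolding denom_def by algebra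
      show ?thesis unfolding d left_diff_distrib by (simp only: mult_ac)
    qed
    also have "\<dots> = - 2 * beta_poly x * (1 + x) ^ 3" by (simp only: deriv_identity)
    finally have "?n * denom x - numer x * ((1 + x) ^ 3 * (3 - 5 * x)) = - 2 * beta_poly x * (1 + x) ^ 3" .
    moreover have "denom x \<noteq> 0" using dpos[OF that] by simp
    note DERIV_divide[OF n d this]
    ultimately show ?thesis by (simp only: power2_eq_square[of "denom x"])
  qed
  have "numer beta / denom beta \<le> numer t / denom t"
  proof (cases "t \<le> beta")
    case True
    show ?thesis
    proof (rule DERIV_nonpos_imp_nonincreasing[OF True])
      fix x assume x: "t \<le> x" "x \<le> beta"
      then have "beta_poly x \<ge> 0" using beta_poly_strict_decreasing[of x beta] b0 b t by (cases "x = beta") auto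
      then have "- 2 * beta_poly x * (1 + x) ^ 3 / (denom x)\<^sup>2 \<le> 0" using x t by (simp add: divide_nonneg_nonneg)
      then show "\<exists>y. ((\<lambda>x. numer x / denom x) has_real_derivative y) (at x) \<and> y \<le> 0"
        using der[of x] x t b by force
    qed
  next
    case False
    then have le: "beta \<le> t" by simp
    show ?thesis
    proof (rule DERIV_nonneg_imp_nondecreasing[OF le])
      fix x assume x: "beta \<le> x" "x \<le> t"
      then have "beta_poly x \<le> 0" using beta_poly_strict_decreasing[of beta x] b0 b t by (cases "x = beta") auto
      then have "beta_poly x * (1 + x) ^ 3 / (denom x)\<^sup>2 \<le> 0"
        using x b by (intro divide_nonpos_nonneg mult_nonpos_nonneg) auto
      then have "- 2 * beta_poly x * (1 + x) ^ 3 / (denom x)\<^sup>2 \<ge> 0" by simp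
      then show "\<exists>y. ((\<lambda>x. numer x / denom x) has_real_derivative y) (at x) \<and> 0 \<le> y"
        using der[of x] x t b \<open>t \<noteq> 1\<close> by force
    qed
  qed
  moreover have "numer beta / denom beta = 81 * lam / 32"
    using lam_eq dpos[of beta] b by (simp add: divide_eq_eq)
  ultimately show ?thesis
    using pos_le_divide_eq[OF dpos[of t]] t False by simp
qed

text \<open>\<open>X\<close> is \<open>S / (pi - S)\<close> for the automorphism at
  \<open>r = 1 / 3\<close>. Being exact in \<open>t\<close> and \<open>\<Lambda>\<close>, the
  identity serves both the inequality and the equality case.\<close>

lemma majorant_identity:
  assumes "0 \<le> t" "t \<le> (1::real)"
  defines "X \<equiv> 9 * (1 - t\<^sup>2)\<^sup>2 / (8 * (9 - t ^ 4))"
  shows "t + (1 - t\<^sup>2) / 2 + 8 / 9 * X + \<Lambda> * X\<^sup>2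
    = 1 - (1 - t) ^ 3 * (numer t - 81 * \<Lambda> / 32 * denom t) / (2 * (9 - t ^ 4)\<^sup>2)"
proof -
  have "t ^ 4 \<le> 1" using assms by (simp add: power_le_one)
  then have E: "9 - t ^ 4 \<noteq> 0" by simp
  define E where "E = 9 - t ^ 4"
  have X: "X = 9 / 8 * (1 - t\<^sup>2)\<^sup>2 / E" by (simp add: X_def E_def)
  have expand: "(1 - t) ^ 3 * (numer t - L * denom t) = (1 - t)\<^sup>2 * E\<^sup>2 - 2 * E * (1 - t\<^sup>2)\<^sup>2 - L * ((1 - t\<^sup>2)\<^sup>2)\<^sup>2" for L
    unfolding numer_def denom_def E_def by algebra
  have half: "(1 - t)\<^sup>2 = 2 * (1 - t - (1 - t\<^sup>2) / 2)" by (simp add: power2_eq_square field_simps)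
  have "(2 * G * E\<^sup>2 - 2 * E * H - 81 * \<Lambda> / 32 * H\<^sup>2) / (2 * E\<^sup>2) = G - H / E - \<Lambda> * (81 / 64 * (H / E)\<^sup>2)" for G H
    using E unfolding E_def[symmetric] diff_divide_distrib by (simp add: power2_eq_square)
  note quotient = this[of "1 - t - (1 - t\<^sup>2) / 2" "(1 - t\<^sup>2)\<^sup>2"]
  have "(9 / 8 * H / E)\<^sup>2 = 81 / 64 * (H / E)\<^sup>2" "8 / 9 * (9 / 8 * H / E) = H / E" for H
    by (simp_all add: power_divide power_mult_distrib)
  then show ?thesis unfolding X E_def[symmetric] expand half quotient by simp
qed

subsection \<open>The sharp inequality\<close>

context bounded_power_series
begin

lemma bohr_expr_lam_le_1:
  assumes r: "0 < r" "r \<le> 1 / 3"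
  shows "bohr_expr lam f a r \<le> 1"
proof -
  define t where "t = cmod (a 0)"
  have t: "0 \<le> t" "t \<le> 1" using norm_coeff_0_le_1 by (simp_all add: t_def)
  define x where "x = S f r / pi"
  define X where "X = 9 * (1 - t\<^sup>2)\<^sup>2 / (8 * (9 - t ^ 4))"
  \<comment> \<open>The area bound at \<open>r = 1 / 3\<close>; \<open>X\<close> is its image under
    \<open>y / (1 - y)\<close>.\<close>
  define y where "y = 9 * (1 - t\<^sup>2)\<^sup>2 / (9 - t\<^sup>2)\<^sup>2"
  have r2: "r\<^sup>2 \<le> 1 / 9" using power_mono[OF r(2), of 2] r by (simp add: power2_eq_square)
  have t2: "0 \<le> t\<^sup>2" "t\<^sup>2 \<le> 1" and t4: "t ^ 4 \<le> 1" using t by (auto simp: power_le_one)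
  have "x \<le> r\<^sup>2 * (1 - t\<^sup>2)\<^sup>2 / (1 - t\<^sup>2 * r\<^sup>2)\<^sup>2"
    unfolding x_def t_def using r r2 by (intro area_bound) auto
  also have "\<dots> \<le> 1 / 9 * (1 - t\<^sup>2)\<^sup>2 / (1 - t\<^sup>2 * (1 / 9))\<^sup>2"
    using r2 t2 by (intro frac_le mult_right_mono power_mono diff_left_mono mult_left_mono) auto
  also have "\<dots> = y"
  proof -
    have *: "1 - t\<^sup>2 * (1 / 9) = (9 - t\<^sup>2) / 9" by simp
    show ?thesis unfolding * y_def power_divide by simp
  qed
  finally have xy: "x \<le> y" .
  have x0: "0 \<le> x" using S_nonneg[of r] r by (simp add: x_def)
  have d: "(9 - t\<^sup>2)\<^sup>2 > 0" using t2 by simp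
  \<comment> \<open>This factorisation gives \<open>1 - y > 0\<close>, hence
    \<open>S f r < pi\<close>, so that the quotients below are genuine.\<close>
  have e: "(9 - t\<^sup>2)\<^sup>2 - 9 * (1 - t\<^sup>2)\<^sup>2 = 8 * (9 - t ^ 4)" by (simp add: eval_nat_numeral algebra_simps)
  have y1: "1 - y = 8 * (9 - t ^ 4) / (9 - t\<^sup>2)\<^sup>2" using d by (simp add: y_def diff_divide_eq_iff e)
  then have "1 - y > 0" using d t4 by simp
  have yX: "y / (1 - y) = X" unfolding y1 using d by (simp add: y_def X_def)
  have "S f r / (pi - S f r) = x / (1 - x)"
    by (simp add: x_def divide_simps)
  also have "\<dots> \<le> y / (1 - y)" using xy x0 \<open>1 - y > 0\<close> by (intro frac_le) auto
  finally have sX: "S f r / (pi - S f r) \<le> X" unfolding yX .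
  have "0 \<le> x / (1 - x)" using x0 xy \<open>1 - y > 0\<close> by simp
  then have s0: "0 \<le> S f r / (pi - S f r)"
    using \<open>S f r / (pi - S f r) = x / (1 - x)\<close> by simp
  have refined: "(\<Sum>n. cmod (a n) * r ^ n) + (1 / (1 + t) + r / (1 - r)) * (\<Sum>k. (cmod (a (Suc k)))\<^sup>2 * r ^ (2 * Suc k))
      \<le> t + (1 - t\<^sup>2) * r / (1 - r)"
    unfolding t_def using r by (intro refined_bohr) auto
  have lam0: "lam \<ge> 0" using lam_bounds(1) by (rule order.trans[rotated]) simp
  have "lam * (S f r / (pi - S f r))\<^sup>2 \<le> lam * X\<^sup>2"
    using sX s0 lam0 by (intro mult_left_mono power_mono)
  moreover have "(1 - t\<^sup>2) * r / (1 - r) \<le> (1 - t\<^sup>2) * (1 / 2)"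
  proof -
    have "r / (1 - r) \<le> 1 / 2" using r by (simp add: divide_simps)
    then have "(1 - t\<^sup>2) * (r / (1 - r)) \<le> (1 - t\<^sup>2) * (1 / 2)" using t2 by (intro mult_left_mono) auto
    then show ?thesis by simp
  qed
  ultimately have "bohr_expr lam f a r \<le> t + (1 - t\<^sup>2) / 2 + 8 / 9 * X + lam * X\<^sup>2"
    using refined sX unfolding bohr_expr_def t_def[symmetric] by linarith
  also have "\<dots> \<le> 1"
    unfolding X_def majorant_identity[OF t] using lam_minimal[OF t] t by simp
  finally show ?thesis .
qed

end

section \<open>The extremal function\<close>

lemma norm_f_ext_le_1:
  assumes "0 < b" "b < 1" "cmod z < 1"
  shows "cmod (f_ext b z) \<le> 1" and "1 - complex_of_real b * z \<noteq> 0"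
proof -
  have "cmod (of_real b * z) < 1" using assms mult_strict_mono[of b 1 "cmod z" 1] by (simp add: norm_mult)
  then show nz: "1 - complex_of_real b * z \<noteq> 0" by auto
  have "(cmod (1 - of_real b * z))\<^sup>2 - (cmod (of_real b - z))\<^sup>2 = (1 - b\<^sup>2) * (1 - (cmod z)\<^sup>2)"
    unfolding cmod_power2 by (simp add: power2_eq_square algebra_simps)
  moreover have "0 \<le> (1 - b\<^sup>2) * (1 - (cmod z)\<^sup>2)"
    using assms by (intro mult_nonneg_nonneg) (auto simp: power_le_one)
  ultimately have "(cmod (of_real b - z))\<^sup>2 \<le> (cmod (1 - of_real b * z))\<^sup>2" by linarith
  then have "cmod (of_real b - z) \<le> cmod (1 - of_real b * z)" by (rule power2_le_imp_le) simp
  then show "cmod (f_ext b z) \<le> 1" using nz by (simp add: f_ext_def norm_divide)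
qed

text \<open>From \<open>f_ext b z = b - (1 - b\<^sup>2) * z / (1 - b * z)\<close> and the geometric
  series.\<close>

lemma f_ext_power_series:
  assumes "0 < b" "b < 1" "cmod z < 1"
  shows "(\<lambda>n. (case n of 0 \<Rightarrow> of_real b | Suc k \<Rightarrow> - of_real ((1 - b\<^sup>2) * b ^ k)) * z ^ n) sums f_ext b z"
proof -
  have "cmod (of_real b * z) < 1" using assms mult_strict_mono[of b 1 "cmod z" 1] by (simp add: norm_mult)
  then have "(\<lambda>k. (of_real b * z) ^ k) sums (1 / (1 - of_real b * z))" by (rule geometric_sums)
  then have "(\<lambda>k. - of_real (1 - b\<^sup>2) * z * (of_real b * z) ^ k) sums (- of_real (1 - b\<^sup>2) * z * (1 / (1 - of_real b * z)))"
    by (rule sums_mult)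
  moreover have "- of_real (1 - b\<^sup>2) * z * (of_real b * z) ^ k = - of_real ((1 - b\<^sup>2) * b ^ k) * z ^ Suc k" for k
    by (simp add: power_mult_distrib mult_ac del: of_real_diff)
  moreover have "- of_real (1 - b\<^sup>2) * z * (1 / (1 - of_real b * z)) = f_ext b z - of_real b"
    using norm_f_ext_le_1(2)[OF assms] by (simp add: f_ext_def field_simps power2_eq_square)
  ultimately have "(\<lambda>k. - of_real ((1 - b\<^sup>2) * b ^ k) * z ^ Suc k) sums (f_ext b z - of_real b)"
    by (simp only:)
  then show ?thesis
    using sums_Suc[of "\<lambda>n. (case n of 0 \<Rightarrow> of_real b | Suc k \<Rightarrow> - of_real ((1 - b\<^sup>2) * b ^ k)) * z ^ n" "f_ext b z - of_real b"] by simp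
qed

text \<open>For the automorphism every estimate leading to the majorant is an equality at
  \<open>r = 1 / 3\<close>, so the value is the majorant itself, whatever \<open>b\<close> and
  \<open>\<Lambda>\<close> are.\<close>

lemma bohr_expr_f_ext:
  assumes b: "0 < b" "b < 1"
  defines "a \<equiv> (\<lambda>n. case n of 0 \<Rightarrow> of_real b | Suc k \<Rightarrow> - of_real ((1 - b\<^sup>2) * b ^ k))"
  shows "bohr_expr \<Lambda> (f_ext b) a (1 / 3)
    = 1 - (1 - b) ^ 3 * (numer b - 81 * \<Lambda> / 32 * denom b) / (2 * (9 - b ^ 4)\<^sup>2)"
proof -
  interpret bounded_power_series "f_ext b" a
    by unfold_locales (use f_ext_power_series[OF b] norm_f_ext_le_1[OF b] in \<open>auto simp: a_def\<close>)
  define \<delta> where "\<delta> = 1 - b\<^sup>2"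
  have \<delta>: "\<delta> > 0" using b by (simp add: \<delta>_def power_less_one_iff)
  have a_Suc: "cmod (a (Suc k)) = \<delta> * b ^ k" for k
    using b \<delta> by (simp add: a_def norm_mult norm_power \<delta>_def[symmetric] del: of_real_mult of_real_power)
  have a_0: "cmod (a 0) = b" using b by (simp add: a_def)
  have "(\<lambda>k. (b / 3) ^ k) sums (1 / (1 - b / 3))" using b by (intro geometric_sums) simp
  from sums_mult[OF this, of "\<delta> / 3"]
  have "(\<lambda>k. cmod (a (Suc k)) * (1 / 3) ^ Suc k) sums (\<delta> / (3 - b))"
    using b by (simp add: a_Suc power_divide field_simps)
  then have 1: "(\<Sum>n. cmod (a n) * (1 / 3) ^ n) = b + \<delta> / (3 - b)"
    by (subst (asm) sums_Suc_iff) (simp add: sums_iff a_0)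
  have b2: "b\<^sup>2 < 1" using b by (simp add: power_less_one_iff)
  then have geo: "norm (b\<^sup>2 / 9) < 1" by simp
  have sq_term: "(cmod (a (Suc k)))\<^sup>2 * (1 / 3) ^ (2 * Suc k) = \<delta>\<^sup>2 / 9 * (b\<^sup>2 / 9) ^ k" for k
  proof -
    have "(1 / 3 :: real) ^ (2 * Suc k) = 1 / 9 * (1 / 9) ^ k" by (simp add: power_mult power2_eq_square)
    moreover have "(b ^ k)\<^sup>2 = (b\<^sup>2) ^ k" by (simp add: mult.commute flip: power_mult)
    ultimately show ?thesis by (simp add: a_Suc power_mult_distrib power_divide)
  qed
  have "(\<lambda>k. (cmod (a (Suc k)))\<^sup>2 * (1 / 3) ^ (2 * Suc k)) sums (\<delta>\<^sup>2 / 9 * (1 / (1 - b\<^sup>2 / 9)))"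
    unfolding sq_term by (intro sums_mult geometric_sums geo)
  then have 2: "(\<Sum>k. (cmod (a (Suc k)))\<^sup>2 * (1 / 3) ^ (2 * Suc k)) = \<delta>\<^sup>2 / (9 - b\<^sup>2)"
    by (simp add: sums_iff divide_simps)
  have "(\<lambda>k. \<delta>\<^sup>2 / 9 * (of_nat (Suc k) * (b\<^sup>2 / 9) ^ k)) sums (\<delta>\<^sup>2 / 9 * (1 / (1 - b\<^sup>2 / 9)\<^sup>2))"
    by (intro sums_mult geometric_deriv_sums geo)
  moreover have "\<delta>\<^sup>2 / 9 * (of_nat (Suc k) * (b\<^sup>2 / 9) ^ k) = real (Suc k) * (1 / 3) ^ (2 * Suc k) * (cmod (a (Suc k)))\<^sup>2" for k
  proof -
    have "\<delta>\<^sup>2 / 9 * (of_nat (Suc k) * (b\<^sup>2 / 9) ^ k) = real (Suc k) * (\<delta>\<^sup>2 / 9 * (b\<^sup>2 / 9) ^ k)"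
      by (simp only: mult_ac)
    also have "\<dots> = real (Suc k) * ((cmod (a (Suc k)))\<^sup>2 * (1 / 3) ^ (2 * Suc k))" by (simp only: sq_term)
    finally show ?thesis by (simp only: mult_ac)
  qed
  ultimately have "(\<lambda>k. real (Suc k) * (1 / 3) ^ (2 * Suc k) * (cmod (a (Suc k)))\<^sup>2) sums (\<delta>\<^sup>2 / 9 * (1 / (1 - b\<^sup>2 / 9)\<^sup>2))"
    by (simp only:)
  moreover have "(\<lambda>k. real (Suc k) * (1 / 3) ^ (2 * Suc k) * (cmod (a (Suc k)))\<^sup>2) sums (S (f_ext b) (1 / 3) / pi)"
    by (rule area_sums) simp_all
  ultimately have S1: "S (f_ext b) (1 / 3) / pi = \<delta>\<^sup>2 / 9 * (1 / (1 - b\<^sup>2 / 9)\<^sup>2)"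
    by (rule sums_unique2[symmetric])
  define y where "y = 9 * \<delta>\<^sup>2 / (9 - b\<^sup>2)\<^sup>2"
  have "1 - b\<^sup>2 / 9 = (9 - b\<^sup>2) / 9" by simp
  from S1[unfolded this] have "S (f_ext b) (1 / 3) / pi = y" by (simp add: y_def power_divide)
  then have Sy: "S (f_ext b) (1 / 3) = pi * y" by (simp add: divide_eq_eq mult.commute)
  have e: "(9 - b\<^sup>2)\<^sup>2 - 9 * \<delta>\<^sup>2 = 8 * (9 - b ^ 4)" by (simp add: \<delta>_def eval_nat_numeral algebra_simps)
  have d: "(9 - b\<^sup>2)\<^sup>2 > 0" using b2 by simp
  have y1: "1 - y = 8 * (9 - b ^ 4) / (9 - b\<^sup>2)\<^sup>2" using d by (simp add: y_def diff_divide_eq_iff e)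
  have "pi - pi * y = pi * (1 - y)" by (simp add: algebra_simps)
  then have "S (f_ext b) (1 / 3) / (pi - S (f_ext b) (1 / 3)) = y / (1 - y)"
    unfolding Sy by simp
  also have "\<dots> = 9 * (1 - b\<^sup>2)\<^sup>2 / (8 * (9 - b ^ 4))"
    unfolding y1 using d by (simp add: y_def \<delta>_def)
  finally have 3: "S (f_ext b) (1 / 3) / (pi - S (f_ext b) (1 / 3)) = 9 * (1 - b\<^sup>2)\<^sup>2 / (8 * (9 - b ^ 4))" .
  \<comment> \<open>The refined Bohr bound is attained: the tail of the coefficient sum and the
    weighted square sum add up to \<open>\<delta> / 2\<close>.\<close>
  have 4: "\<delta> / (3 - b) + (1 / (1 + b) + 1 / 3 / (1 - 1 / 3)) * (\<delta>\<^sup>2 / (9 - b\<^sup>2)) = \<delta> / 2"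
  proof -
    have "9 - b\<^sup>2 = (3 - b) * (3 + b)" "\<delta> = (1 - b) * (1 + b)" by (simp_all add: \<delta>_def power2_eq_square algebra_simps)
    moreover have "p / (2 * q) * ((w * q)\<^sup>2 / (m * p)) = w * q * w / (2 * m)" if "p \<noteq> 0" "q \<noteq> 0" for p q m w :: real
      using that by (simp add: power2_eq_square)
    from this[of "3 + b" "1 + b" "1 - b" "3 - b"]
    have "(3 + b) / (2 * (1 + b)) * (((1 - b) * (1 + b))\<^sup>2 / ((3 - b) * (3 + b))) = (1 - b) * (1 + b) * (1 - b) / (2 * (3 - b))"
      using b by simp
    moreover have "1 / (1 + b) + 1 / 3 / (1 - 1 / 3) = (3 + b) / (2 * (1 + b))" using b by (simp add: field_simps)
    ultimately have "(1 / (1 + b) + 1 / 3 / (1 - 1 / 3)) * (\<delta>\<^sup>2 / (9 - b\<^sup>2)) = \<delta> * (1 - b) / (2 * (3 - b))"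
      by (simp only:)
    then show ?thesis using b by (simp add: field_simps)
  qed
  have "bohr_expr \<Lambda> (f_ext b) a (1 / 3) = b + (1 - b\<^sup>2) / 2 + 8 / 9 * (9 * (1 - b\<^sup>2)\<^sup>2 / (8 * (9 - b ^ 4)))
      + \<Lambda> * (9 * (1 - b\<^sup>2)\<^sup>2 / (8 * (9 - b ^ 4)))\<^sup>2"
    unfolding bohr_expr_def 1 2 3 a_0 using 4 unfolding \<delta>_def by linarith
  then show ?thesis using majorant_identity[of b \<Lambda>] b by simp
qed

theorem theorem2p10:
  shows "(\<exists>!t. beta_root t)
    \<and> \<bar>beta - 531615 / 10 ^ 6\<bar> < 1 / (2 * 10 ^ 6)
    \<and> 123427 / 10 ^ 4 \<le> lam \<and> lam < 123428 / 10 ^ 4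
    \<and> (\<forall>(f :: complex \<Rightarrow> complex) (a :: nat \<Rightarrow> complex) (r :: real).
          f analytic_on unit_disc \<longrightarrow> has_power_series f a \<longrightarrow>
          (\<forall>z\<in>unit_disc. cmod (f z) \<le> 1) \<longrightarrow> 0 < r \<longrightarrow> r \<le> 1 / 3 \<longrightarrow>
          bohr_expr lam f a r \<le> 1)
    \<and> f_ext beta analytic_on unit_disc
    \<and> (\<forall>z\<in>unit_disc. cmod (f_ext beta z) \<le> 1)
    \<and> (\<exists>b. has_power_series (f_ext beta) b \<and> bohr_expr lam (f_ext beta) b (1 / 3) = 1)"
proof (intro conjI allI impI)
  note b = beta_root_unique_approx(3,4)
  have beta: "0 < beta" "beta < 1" using b by simp_all
  show "\<exists>!t. beta_root t" by (rule beta_root_unique_approx)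
  show "\<bar>beta - 531615 / 10 ^ 6\<bar> < 1 / (2 * 10 ^ 6)" using b by (simp add: abs_if)
  show "123427 / 10 ^ 4 \<le> lam" "lam < 123428 / 10 ^ 4" by (rule lam_bounds)+
  show "bohr_expr lam f a r \<le> 1"
    if "has_power_series f a" "\<forall>z\<in>unit_disc. cmod (f z) \<le> 1" "0 < r" "r \<le> 1 / 3" for f a r
  proof -
    interpret bounded_power_series f a
      by unfold_locales (use that in \<open>auto simp: has_power_series_def\<close>)
    show ?thesis using that by (intro bohr_expr_lam_le_1)
  qed
  show "f_ext beta analytic_on unit_disc"
    unfolding f_ext_def[abs_def] using norm_f_ext_le_1(2)[OF beta] by (intro analytic_intros) auto
  show "\<forall>z\<in>unit_disc. cmod (f_ext beta z) \<le> 1"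
    using norm_f_ext_le_1(1)[OF beta] by auto
  \<comment> \<open>By \<open>lam_eq\<close> the bracket in \<open>bohr_expr_f_ext\<close> vanishes
    at \<open>b = beta\<close>.\<close>
  show "\<exists>b. has_power_series (f_ext beta) b \<and> bohr_expr lam (f_ext beta) b (1 / 3) = 1"
    using f_ext_power_series[OF beta] bohr_expr_f_ext[OF beta, of lam] lam_eq
    unfolding has_power_series_def by (intro exI conjI) auto
qed

end
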